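(* If $\mathcal{L}$ is a first-order logic over $\mathscr{L}$ with $\mathcal{L} \supseteq \mathcal{L}^{m}$ (i.e.\ every instance of the rules of $\mathcal{L}^{m}$ listed below is derivable in $\mathcal{L}$), then $\mathcal{L}$ is adequate.
   Context: Fix a first-order language $\mathscr{L}$: a collection $\mathscr{L}_{q}$ of quantifier symbols and a collection $\mathscr{L}_{\omega}$ of propositional connectives, each with an arity in $\omega$; $\mathscr{L}_{n}$ denotes the $n$-ary connectives. Assume $\mathscr{L}$ has designated connectives $e \in \mathscr{L}_{0}$ and $\otimes \in \mathscr{L}_{2}$. Terms, formulas and sequents are taken in context $\Gamma = [x_{1}:\sigma_{1},\ldots,x_{n}:\sigma_{n}]$ over a multi-sorted signature $Sg$; formulas are built from atomic formulas $R(M_{1},\ldots,M_{n})$ and $M_{1} =_{\sigma} M_{2}$ using the connectives $\Diamond(\phi_{1},\ldots,\phi_{n})$ for $\Diamond \in \mathscr{L}_{n}$ and quantifiers $\Omega_{x:\sigma}(\phi)\,[\Gamma]$ (from $\phi\,[\Gamma,x:\sigma]$) for $\Omega \in \mathscr{L}_{q}$. Assertions are equations-in-context $M_{1}=M_{2}:\tau\ [\Gamma]$ and sequents-in-context $\phi_{1},\ldots,\phi_{n} \vdash \phi_{n+1}\ [\Gamma]$; a theory is a signature together with a set of assertions. A (first-order) logic is, for each signature, a closure operator on the lattice of theories over that signature, assumed to contain the rules of typed equational logic; an $\mathcal{L}$-theory is a theory closed under $\mathcal{L}$. $\mathcal{L}^{m}$ is the logic given by the rules: Ax: $\phi \vdash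 \phi\ [\Gamma]$; Cut: from $\phi \vdash \psi\ [\Gamma]$ and $\psi \vdash \theta\ [\Gamma]$ infer $\phi \vdash \theta\ [\Gamma]$; Cwk: from $\Phi \vdash \psi\ [\Gamma]$ infer $\Phi \vdash \psi\ [\Gamma,x:\sigma]$; Sub: from $M = M':\sigma\ [\Delta]$ and $\Phi \vdash \psi\ [\Gamma,x:\sigma,\Gamma']$ infer $\Phi[M/x] \vdash \psi[M'/x]\ [\Gamma,\Gamma']$ (where the variable–sort pairs of $\Delta$ are among those of $\Gamma,\Gamma'$); $\Omega$-Con (each $\Omega\in\mathscr{L}_{q}$): from $\phi \vdash \psi$ and $\psi \vdash \phi\ [\Gamma,x:\sigma]$ infer $\Omega_{x:\sigma}(\phi) \vdash \Omega_{x:\sigma}(\psi)\ [\Gamma]$; $\Diamond$-Cong (each $n$ and $\Diamond\in\mathscr{L}_{n}$): from $\phi_{i} \vdash \phi_{i}'$ and $\phi_{i}' \vdash \phi_{i}\ [\Gamma]$ for all $i$ infer $\Diamond(\phi_{1},\ldots,\phi_{n}) \vdash \Diamond(\phi'_{1},\ldots,\phi'_{n})\ [\Gamma]$; $\otimes$-Ref (two-way): $\Phi,\alpha,\beta,\Psi \vdash \theta\ [\Gamma]$ iff $\Phi,\alpha\otimes\beta,\Psi \vdash \theta\ [\Gamma]$; $e$-Ref (two-way): $\Phi,e,\Psi \vdash \phi\ [\Gamma]$ iff $\Phi,\Psi \vdash \phi\ [\Gamma]$. A prop-category $(\mathcal{C},P)$ is a category $\mathcal{C}$ with designated finite products and a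 contravariant functor $P\colon \mathcal{C}\to\mathbf{Pos}$. $\mathrm{Ob}(\mathbf{FA})$ consists of prop-categories such that: (1) each $P(c)$ is an $\mathscr{L}_{\omega}$-algebra and each $P(f)$ an $\mathscr{L}_{\omega}$-homomorphism; (2) there is a designated $Eq_{c}\in P(c\times c)$; (3) for each $c$ and $\Omega\in\mathscr{L}_{q}$ there is a natural transformation $\Omega_{(\cdot),c}\colon UP(-\times c)\Rightarrow UP$ ($U$ the forgetful functor to $\mathbf{Set}$); (4) $(P(c),\otimes,e_{c})$ is a monoid; (5) $\Omega_{b,1}\circ P(\pi_{1}^{b,1}) = \mathrm{id}$ and $\Omega_{b,c\times d}\circ P(a_{b,c,d}) = \Omega_{b,c}\circ\Omega_{b\times c,d}$ with $a_{b,c,d}$ the reassociation isomorphism; (6) $Eq_{1}=e_{1\times 1}$ and $Eq_{c_{1}\times c_{2}}$ is the $\otimes$ of the reindexings of $Eq_{c_{1}}$ and $Eq_{c_{2}}$ along the evident projections. For a theory $T$, the classifying prop-category $(\mathcal{C}_{T},P_{T})$ has contexts as objects, lists of $T$-provably-equal classes of terms as morphisms (composition by substitution), $P_{T}(\Gamma)$ the poset of formulas in context $\Gamma$ modulo $T$-interderivability ordered by $T$-derivability of sequents, $P_{T}$ acting by substitution, connectives and $e$ interpreted syntactically, $\Omega_{\Gamma,\Gamma'}$ by iterated quantification over the variables of $\Gamma'$, and $Eq_{\Gamma}$ as $x_{1}=_{\sigma_{1}}x'_{1}\otimes\cdots\otimes x_{n}=_{\sigma_{n}}x'_{n}$. A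 logic $\mathcal{L}$ is adequate if for each $\mathcal{L}$-theory $T$ this construction is well defined and $(\mathcal{C}_{T},P_{T})\in\mathrm{Ob}(\mathbf{FA})$. *)

theory Defs
  imports "HOL-Algebra.Group"
begin

section \<open>First-order languages, signatures and syntax\<close>

record ('q, 'c) lang =
  quants :: "'q set"
  conns :: "'c \<rightharpoonup> nat"
  unit_conn :: 'c
  tensor_conn :: 'c

definition wf_lang :: "('q, 'c) lang \<Rightarrow> bool" where
  "wf_lang LL \<longleftrightarrow> conns LL (unit_conn LL) = Some 0 \<and> conns LL (tensor_conn LL) = Some 2"

record ('s, 'f, 'r) signature =
  sorts :: "'s set"
  funs :: "'f \<rightharpoonup> 's list \<times> 's"
  rels :: "'r \<rightharpoonup> 's list"

text \<open>Variables are de Bruijn indices, so formulas and contexts are taken up to renaming of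
  variables. A context is the list of its sorts with the variable declared last at the head:
  \<open>\<Gamma>, x : \<sigma>, \<Gamma>'\<close> is \<open>\<Gamma>' @ \<sigma> # \<Gamma>\<close>, and \<open>Var i\<close> is the variable at position \<open>i\<close>.\<close>

type_synonym 's ctx = "'s list"

definition is_ctx :: "('s, 'f, 'r) signature \<Rightarrow> 's ctx \<Rightarrow> bool" where
  "is_ctx Sg \<Gamma> \<longleftrightarrow> set \<Gamma> \<subseteq> sorts Sg"

definition wf_sig :: "('s, 'f, 'r) signature \<Rightarrow> bool" where
  "wf_sig Sg \<longleftrightarrow>
     (\<forall>f \<sigma>s \<tau>. funs Sg f = Some (\<sigma>s, \<tau>) \<longrightarrow> set \<sigma>s \<subseteq> sorts Sg \<and> \<tau> \<in> sorts Sg) \<and>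
     (\<forall>r \<sigma>s. rels Sg r = Some \<sigma>s \<longrightarrow> set \<sigma>s \<subseteq> sorts Sg)"

datatype 'f trm = Var nat | Fn 'f "'f trm list"

datatype ('q, 'c, 's, 'f, 'r) fm =
    Rel 'r "'f trm list"
  | Eql 's "'f trm" "'f trm"
  | Conn 'c "('q, 'c, 's, 'f, 'r) fm list"
  | Qnt 'q 's "('q, 'c, 's, 'f, 'r) fm"

inductive has_sort :: "('s, 'f, 'r) signature \<Rightarrow> 's ctx \<Rightarrow> 'f trm \<Rightarrow> 's \<Rightarrow> bool"
  for Sg :: "('s, 'f, 'r) signature" and \<Gamma> :: "'s ctx" where
    Var: "i < length \<Gamma> \<Longrightarrow> has_sort Sg \<Gamma> (Var i) (\<Gamma> ! i)"
  | Fn: "funs Sg f = Some (\<sigma>s, \<tau>) \<Longrightarrow> list_all2 (has_sort Sg \<Gamma>) ts \<sigma>s \<Longrightarrow>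
         has_sort Sg \<Gamma> (Fn f ts) \<tau>"

inductive wf_fm :: "('q, 'c) lang \<Rightarrow> ('s, 'f, 'r) signature \<Rightarrow> 's ctx \<Rightarrow>
    ('q, 'c, 's, 'f, 'r) fm \<Rightarrow> bool"
  for LL :: "('q, 'c) lang" and Sg :: "('s, 'f, 'r) signature" where
    Rel: "rels Sg r = Some \<sigma>s \<Longrightarrow> list_all2 (has_sort Sg \<Gamma>) ts \<sigma>s \<Longrightarrow> wf_fm LL Sg \<Gamma> (Rel r ts)"
  | Eql: "\<sigma> \<in> sorts Sg \<Longrightarrow> has_sort Sg \<Gamma> M \<sigma> \<Longrightarrow> has_sort Sg \<Gamma> N \<sigma> \<Longrightarrow> wf_fm LL Sg \<Gamma> (Eql \<sigma> M N)"
  | Conn: "conns LL c = Some (length \<phi>s) \<Longrightarrow> (\<forall>\<phi> \<in> set \<phi>s. wf_fm LL Sg \<Gamma> \<phi>) \<Longrightarrow>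
           wf_fm LL Sg \<Gamma> (Conn c \<phi>s)"
  | Qnt: "Q \<in> quants LL \<Longrightarrow> \<sigma> \<in> sorts Sg \<Longrightarrow> wf_fm LL Sg (\<sigma> # \<Gamma>) \<phi> \<Longrightarrow> wf_fm LL Sg \<Gamma> (Qnt Q \<sigma> \<phi>)"

primrec subst :: "(nat \<Rightarrow> 'f trm) \<Rightarrow> 'f trm \<Rightarrow> 'f trm" where
  "subst s (Var i) = s i"
| "subst s (Fn f ts) = Fn f (map (subst s) ts)"

definition lift :: "(nat \<Rightarrow> 'f trm) \<Rightarrow> nat \<Rightarrow> 'f trm" where
  "lift s i = (case i of 0 \<Rightarrow> Var 0 | Suc j \<Rightarrow> subst (\<lambda>k. Var (Suc k)) (s j))"

primrec fsubst :: "(nat \<Rightarrow> 'f trm) \<Rightarrow> ('q, 'c, 's, 'f, 'r) fm \<Rightarrow> ('q, 'c, 's, 'f, 'r) fm" where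
  "fsubst s (Rel r ts) = Rel r (map (subst s) ts)"
| "fsubst s (Eql \<sigma> M N) = Eql \<sigma> (subst s M) (subst s N)"
| "fsubst s (Conn c \<phi>s) = Conn c (map (fsubst s) \<phi>s)"
| "fsubst s (Qnt Q \<sigma> \<phi>) = Qnt Q \<sigma> (fsubst (lift s) \<phi>)"

text \<open>\<open>M\<close> for the variable \<open>x\<close> at position \<open>k = length \<Gamma>'\<close> of \<open>\<Gamma>, x : \<sigma>, \<Gamma>'\<close>; the result lives in
  \<open>\<Gamma>, \<Gamma>'\<close>.\<close>

definition sub_at :: "nat \<Rightarrow> 'f trm \<Rightarrow> nat \<Rightarrow> 'f trm" where
  "sub_at k M i = (if i < k then Var i else if i = k then M else Var (i - 1))"

text \<open>\<open>Ms ! i\<close> for the variable at position \<open>i\<close>, simultaneously for all \<open>i < length Ms\<close>.\<close>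

definition inst :: "'f trm list \<Rightarrow> nat \<Rightarrow> 'f trm" where
  "inst Ms i = (if i < length Ms then Ms ! i else Var i)"

text \<open>With nameless variables, ``the variable-sort pairs of \<open>\<Delta>\<close> are among those of \<open>\<Gamma>\<close>'' means that
  \<open>\<rho>\<close> identifies the variables of \<open>\<Delta>\<close> injectively with variables of \<open>\<Gamma>\<close> of the same sort; a term
  over \<open>\<Delta>\<close> is then read over \<open>\<Gamma>\<close> as \<open>subst (Var \<circ> \<rho>) M\<close>.\<close>

definition subctx :: "(nat \<Rightarrow> nat) \<Rightarrow> 's ctx \<Rightarrow> 's ctx \<Rightarrow> bool" where
  "subctx \<rho> \<Delta> \<Gamma> \<longleftrightarrow> inj_on \<rho> {..<length \<Delta>} \<and>
     (\<forall>i < length \<Delta>. \<rho> i < length \<Gamma> \<and> \<Gamma> ! \<rho> i = \<Delta> ! i)"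


section \<open>Theories and logics\<close>

datatype ('q, 'c, 's, 'f, 'r) assertion =
    Equation "'s ctx" "'f trm" "'f trm" 's
  | Sequent "'s ctx" "('q, 'c, 's, 'f, 'r) fm list" "('q, 'c, 's, 'f, 'r) fm"

fun wf_assertion :: "('q, 'c) lang \<Rightarrow> ('s, 'f, 'r) signature \<Rightarrow>
    ('q, 'c, 's, 'f, 'r) assertion \<Rightarrow> bool" where
  "wf_assertion LL Sg (Equation \<Gamma> M N \<sigma>) \<longleftrightarrow> is_ctx Sg \<Gamma> \<and> has_sort Sg \<Gamma> M \<sigma> \<and> has_sort Sg \<Gamma> N \<sigma>"
| "wf_assertion LL Sg (Sequent \<Gamma> \<Phi> \<psi>) \<longleftrightarrow>
     is_ctx Sg \<Gamma> \<and> (\<forall>\<phi> \<in> set \<Phi>. wf_fm LL Sg \<Gamma> \<phi>) \<and> wf_fm LL Sg \<Gamma> \<psi>"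

definition assertions :: "('q, 'c) lang \<Rightarrow> ('s, 'f, 'r) signature \<Rightarrow>
    ('q, 'c, 's, 'f, 'r) assertion set" where
  "assertions LL Sg = {a. wf_assertion LL Sg a}"

text \<open>The theories over \<open>Sg\<close> are the subsets of \<open>assertions LL Sg\<close>, ordered by inclusion.\<close>

type_synonym ('q, 'c, 's, 'f, 'r) logic =
  "('s, 'f, 'r) signature \<Rightarrow> ('q, 'c, 's, 'f, 'r) assertion set \<Rightarrow> ('q, 'c, 's, 'f, 'r) assertion set"

definition closure_operator_on :: "'a set \<Rightarrow> ('a set \<Rightarrow> 'a set) \<Rightarrow> bool" where
  "closure_operator_on A cl \<longleftrightarrow>
     (\<forall>T \<subseteq> A. T \<subseteq> cl T \<and> cl T \<subseteq> A \<and> cl (cl T) = cl T) \<and>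
     (\<forall>T T'. T \<subseteq> T' \<and> T' \<subseteq> A \<longrightarrow> cl T \<subseteq> cl T')"

text \<open>A rule relates a set of premises to a conclusion; its instances over \<open>Sg\<close> are the related pairs
  consisting of well-formed assertions over \<open>Sg\<close>.\<close>

type_synonym ('q, 'c, 's, 'f, 'r) rules =
  "('q, 'c, 's, 'f, 'r) assertion set \<Rightarrow> ('q, 'c, 's, 'f, 'r) assertion \<Rightarrow> bool"

definition contains_rules :: "('q, 'c) lang \<Rightarrow> ('q, 'c, 's, 'f, 'r) logic \<Rightarrow>
    ('q, 'c, 's, 'f, 'r) rules \<Rightarrow> bool" where
  "contains_rules LL L R \<longleftrightarrow>
     (\<forall>Sg prems concl. wf_sig Sg \<and> prems \<subseteq> assertions LL Sg \<and> concl \<in> assertions LL Sg \<and>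
        R prems concl \<longrightarrow> concl \<in> L Sg prems)"

inductive equational_rule :: "('q, 'c, 's, 'f, 'r) rules" where
    Refl: "equational_rule {} (Equation \<Gamma> M M \<sigma>)"
  | Sym: "equational_rule {Equation \<Gamma> M M' \<sigma>} (Equation \<Gamma> M' M \<sigma>)"
  | Trans: "equational_rule {Equation \<Gamma> M M' \<sigma>, Equation \<Gamma> M' M'' \<sigma>} (Equation \<Gamma> M M'' \<sigma>)"
  | Subst: "subctx \<rho> \<Delta> (\<Gamma>' @ \<Gamma>) \<Longrightarrow>
      equational_rule {Equation \<Delta> M M' \<sigma>, Equation (\<Gamma>' @ \<sigma> # \<Gamma>) N N' \<tau>}
        (Equation (\<Gamma>' @ \<Gamma>) (subst (sub_at (length \<Gamma>') (subst (Var \<circ> \<rho>) M)) N)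
                           (subst (sub_at (length \<Gamma>') (subst (Var \<circ> \<rho>) M')) N') \<tau>)"

definition is_logic :: "('q, 'c) lang \<Rightarrow> ('q, 'c, 's, 'f, 'r) logic \<Rightarrow> bool" where
  "is_logic LL L \<longleftrightarrow>
     (\<forall>Sg. wf_sig Sg \<longrightarrow> closure_operator_on (assertions LL Sg) (L Sg)) \<and>
     contains_rules LL L equational_rule"

definition is_theory_of :: "('q, 'c) lang \<Rightarrow> ('q, 'c, 's, 'f, 'r) logic \<Rightarrow>
    ('s, 'f, 'r) signature \<Rightarrow> ('q, 'c, 's, 'f, 'r) assertion set \<Rightarrow> bool" where
  "is_theory_of LL L Sg T \<longleftrightarrow> T \<subseteq> assertions LL Sg \<and> L Sg T = T"

abbreviation tensor :: "('q, 'c) lang \<Rightarrow> ('q, 'c, 's, 'f, 'r) fm \<Rightarrow> ('q, 'c, 's, 'f, 'r) fm \<Rightarrow>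
    ('q, 'c, 's, 'f, 'r) fm" where
  "tensor LL \<phi> \<psi> \<equiv> Conn (tensor_conn LL) [\<phi>, \<psi>]"

abbreviation unit_fm :: "('q, 'c) lang \<Rightarrow> ('q, 'c, 's, 'f, 'r) fm" where
  "unit_fm LL \<equiv> Conn (unit_conn LL) []"

inductive Lm_rule :: "('q, 'c) lang \<Rightarrow> ('q, 'c, 's, 'f, 'r) rules" for LL :: "('q, 'c) lang" where
    Ax: "Lm_rule LL {} (Sequent \<Gamma> [\<phi>] \<phi>)"
  | Cut: "Lm_rule LL {Sequent \<Gamma> [\<phi>] \<psi>, Sequent \<Gamma> [\<psi>] \<theta>} (Sequent \<Gamma> [\<phi>] \<theta>)"
  | Cwk: "Lm_rule LL {Sequent \<Gamma> \<Phi> \<psi>}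
      (Sequent (\<sigma> # \<Gamma>) (map (fsubst (\<lambda>i. Var (Suc i))) \<Phi>) (fsubst (\<lambda>i. Var (Suc i)) \<psi>))"
  | Sub: "subctx \<rho> \<Delta> (\<Gamma>' @ \<Gamma>) \<Longrightarrow>
      Lm_rule LL {Equation \<Delta> M M' \<sigma>, Sequent (\<Gamma>' @ \<sigma> # \<Gamma>) \<Phi> \<psi>}
        (Sequent (\<Gamma>' @ \<Gamma>) (map (fsubst (sub_at (length \<Gamma>') (subst (Var \<circ> \<rho>) M))) \<Phi>)
                          (fsubst (sub_at (length \<Gamma>') (subst (Var \<circ> \<rho>) M')) \<psi>))"
  | Quant_Con: "Lm_rule LL {Sequent (\<sigma> # \<Gamma>) [\<phi>] \<psi>, Sequent (\<sigma> # \<Gamma>) [\<psi>] \<phi>}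
      (Sequent \<Gamma> [Qnt Q \<sigma> \<phi>] (Qnt Q \<sigma> \<psi>))"
  | Conn_Cong: "length \<phi>s = length \<phi>s' \<Longrightarrow>
      Lm_rule LL (\<Union>i < length \<phi>s. {Sequent \<Gamma> [\<phi>s ! i] (\<phi>s' ! i), Sequent \<Gamma> [\<phi>s' ! i] (\<phi>s ! i)})
        (Sequent \<Gamma> [Conn c \<phi>s] (Conn c \<phi>s'))"
  | Tensor_Ref1: "Lm_rule LL {Sequent \<Gamma> (\<Phi> @ [\<alpha>, \<beta>] @ \<Psi>) \<theta>} (Sequent \<Gamma> (\<Phi> @ [tensor LL \<alpha> \<beta>] @ \<Psi>) \<theta>)"
  | Tensor_Ref2: "Lm_rule LL {Sequent \<Gamma> (\<Phi> @ [tensor LL \<alpha> \<beta>] @ \<Psi>) \<theta>} (Sequent \<Gamma> (\<Phi> @ [\<alpha>, \<beta>] @ \<Psi>) \<theta>)"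
  | Unit_Ref1: "Lm_rule LL {Sequent \<Gamma> (\<Phi> @ [unit_fm LL] @ \<Psi>) \<phi>} (Sequent \<Gamma> (\<Phi> @ \<Psi>) \<phi>)"
  | Unit_Ref2: "Lm_rule LL {Sequent \<Gamma> (\<Phi> @ \<Psi>) \<phi>} (Sequent \<Gamma> (\<Phi> @ [unit_fm LL] @ \<Psi>) \<phi>)"


section \<open>Prop-categories and the objects of FA\<close>

text \<open>\<open>Cmp C a b c g f\<close> is the composite of \<open>f : a \<rightarrow> b\<close> and \<open>g : b \<rightarrow> c\<close>. Hom-sets need not be
  disjoint, so operations on morphisms take the objects as arguments.\<close>

record ('o, 'm) fp_cat =
  Obj :: "'o set"
  Hom :: "'o \<Rightarrow> 'o \<Rightarrow> 'm set"
  Ide :: "'o \<Rightarrow> 'm"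
  Cmp :: "'o \<Rightarrow> 'o \<Rightarrow> 'o \<Rightarrow> 'm \<Rightarrow> 'm \<Rightarrow> 'm"
  One :: 'o
  Prd :: "'o \<Rightarrow> 'o \<Rightarrow> 'o"
  Fst :: "'o \<Rightarrow> 'o \<Rightarrow> 'm"
  Snd :: "'o \<Rightarrow> 'o \<Rightarrow> 'm"

locale fp_category =
  fixes C :: "('o, 'm, 'z) fp_cat_scheme"
  assumes ide_hom: "a \<in> Obj C \<Longrightarrow> Ide C a \<in> Hom C a a"
    and cmp_hom: "\<lbrakk>a \<in> Obj C; b \<in> Obj C; c \<in> Obj C; f \<in> Hom C a b; g \<in> Hom C b c\<rbrakk> \<Longrightarrow>
          Cmp C a b c g f \<in> Hom C a c"
    and ide_left: "\<lbrakk>a \<in> Obj C; b \<in> Obj C; f \<in> Hom C a b\<rbrakk> \<Longrightarrow> Cmp C a b b (Ide C b) f = f"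
    and ide_right: "\<lbrakk>a \<in> Obj C; b \<in> Obj C; f \<in> Hom C a b\<rbrakk> \<Longrightarrow> Cmp C a a b f (Ide C a) = f"
    and cmp_assoc: "\<lbrakk>a \<in> Obj C; b \<in> Obj C; c \<in> Obj C; d \<in> Obj C;
          f \<in> Hom C a b; g \<in> Hom C b c; h \<in> Hom C c d\<rbrakk> \<Longrightarrow>
          Cmp C a c d h (Cmp C a b c g f) = Cmp C a b d (Cmp C b c d h g) f"
    and one_obj: "One C \<in> Obj C"
    and one_terminal: "a \<in> Obj C \<Longrightarrow> \<exists>!f. f \<in> Hom C a (One C)"
    and prd_obj: "\<lbrakk>a \<in> Obj C; b \<in> Obj C\<rbrakk> \<Longrightarrow> Prd C a b \<in> Obj C"
    and fst_hom: "\<lbrakk>a \<in> Obj C; b \<in> Obj C\<rbrakk> \<Longrightarrow> Fst C a b \<in> Hom C (Prd C a b) a"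
    and snd_hom: "\<lbrakk>a \<in> Obj C; b \<in> Obj C\<rbrakk> \<Longrightarrow> Snd C a b \<in> Hom C (Prd C a b) b"
    and prd_universal: "\<lbrakk>a \<in> Obj C; b \<in> Obj C; c \<in> Obj C; f \<in> Hom C c a; g \<in> Hom C c b\<rbrakk> \<Longrightarrow>
          \<exists>!h. h \<in> Hom C c (Prd C a b) \<and>
               Cmp C c (Prd C a b) a (Fst C a b) h = f \<and>
               Cmp C c (Prd C a b) b (Snd C a b) h = g"

text \<open>The pairing \<open>\<langle>f, g\<rangle> : c \<rightarrow> a \<times> b\<close> of \<open>f : c \<rightarrow> a\<close> and \<open>g : c \<rightarrow> b\<close>.\<close>

definition pairing :: "('o, 'm, 'z) fp_cat_scheme \<Rightarrow> 'o \<Rightarrow> 'o \<Rightarrow> 'o \<Rightarrow> 'm \<Rightarrow> 'm \<Rightarrow> 'm" where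
  "pairing C c a b f g =
     (THE h. h \<in> Hom C c (Prd C a b) \<and>
             Cmp C c (Prd C a b) a (Fst C a b) h = f \<and>
             Cmp C c (Prd C a b) b (Snd C a b) h = g)"

text \<open>\<open>f \<times> id : a \<times> c \<rightarrow> b \<times> c\<close> for \<open>f : a \<rightarrow> b\<close>.\<close>

definition times_ide :: "('o, 'm, 'z) fp_cat_scheme \<Rightarrow> 'o \<Rightarrow> 'o \<Rightarrow> 'o \<Rightarrow> 'm \<Rightarrow> 'm" where
  "times_ide C a b c f =
     pairing C (Prd C a c) b c (Cmp C (Prd C a c) a b f (Fst C a c)) (Snd C a c)"

text \<open>The isomorphism \<open>b \<times> (c \<times> d) \<rightarrow> (b \<times> c) \<times> d\<close>.\<close>

definition reassoc :: "('o, 'm, 'z) fp_cat_scheme \<Rightarrow> 'o \<Rightarrow> 'o \<Rightarrow> 'o \<Rightarrow> 'm" where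
  "reassoc C b c d =
     (let cd = Prd C c d; x = Prd C b cd in
      pairing C x (Prd C b c) d
        (pairing C x b c (Fst C b cd) (Cmp C x cd c (Fst C c d) (Snd C b cd)))
        (Cmp C x cd d (Snd C c d) (Snd C b cd)))"

text \<open>The morphism \<open>k \<times> k : c \<times> c \<rightarrow> a \<times> a\<close> for \<open>k : c \<rightarrow> a\<close>.\<close>

definition square :: "('o, 'm, 'z) fp_cat_scheme \<Rightarrow> 'o \<Rightarrow> 'o \<Rightarrow> 'm \<Rightarrow> 'm" where
  "square C c a k =
     pairing C (Prd C c c) a a
       (Cmp C (Prd C c c) c a k (Fst C c c)) (Cmp C (Prd C c c) c a k (Snd C c c))"

text \<open>\<open>Leq C c\<close> is the order of \<open>P(c)\<close>, and \<open>Reindex C a b f : P(b) \<rightarrow> P(a)\<close> is \<open>P(f)\<close> for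
  \<open>f : a \<rightarrow> b\<close>.\<close>

record ('o, 'm, 'p) prop_cat = "('o, 'm) fp_cat" +
  Pred :: "'o \<Rightarrow> 'p set"
  Leq :: "'o \<Rightarrow> 'p rel"
  Reindex :: "'o \<Rightarrow> 'o \<Rightarrow> 'm \<Rightarrow> 'p \<Rightarrow> 'p"

locale prop_category = fp_category C
  for C :: "('o, 'm, 'p, 'z) prop_cat_scheme" +
  assumes pred_poset: "c \<in> Obj C \<Longrightarrow> partial_order_on (Pred C c) (Leq C c)"
    and reindex_pred: "\<lbrakk>a \<in> Obj C; b \<in> Obj C; f \<in> Hom C a b; p \<in> Pred C b\<rbrakk> \<Longrightarrow>
          Reindex C a b f p \<in> Pred C a"
    and reindex_mono: "\<lbrakk>a \<in> Obj C; b \<in> Obj C; f \<in> Hom C a b; (p, q) \<in> Leq C b\<rbrakk> \<Longrightarrow>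
          (Reindex C a b f p, Reindex C a b f q) \<in> Leq C a"
    and reindex_ide: "\<lbrakk>a \<in> Obj C; p \<in> Pred C a\<rbrakk> \<Longrightarrow> Reindex C a a (Ide C a) p = p"
    and reindex_cmp: "\<lbrakk>a \<in> Obj C; b \<in> Obj C; c \<in> Obj C; f \<in> Hom C a b; g \<in> Hom C b c;
          p \<in> Pred C c\<rbrakk> \<Longrightarrow>
          Reindex C a c (Cmp C a b c g f) p = Reindex C a b f (Reindex C b c g p)"

text \<open>\<open>ConnOp C k c\<close> interprets the connective \<open>k\<close> on \<open>P(c)\<close>, with its arguments as a list;
  \<open>QntOp C Q b c : P(b \<times> c) \<rightarrow> P(b)\<close> is the component at \<open>b\<close> of the transformation for \<open>Q\<close> and \<open>c\<close>.\<close>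

record ('o, 'm, 'p, 'q, 'c) fa_cat = "('o, 'm, 'p) prop_cat" +
  ConnOp :: "'c \<Rightarrow> 'o \<Rightarrow> 'p list \<Rightarrow> 'p"
  QntOp :: "'q \<Rightarrow> 'o \<Rightarrow> 'o \<Rightarrow> 'p \<Rightarrow> 'p"
  EqP :: "'o \<Rightarrow> 'p"

locale FA_object = prop_category C
  for LL :: "('q, 'c) lang" and C :: "('o, 'm, 'p, 'q, 'c, 'z) fa_cat_scheme" +
  assumes conn_pred: "\<lbrakk>a \<in> Obj C; conns LL k = Some (length ps); set ps \<subseteq> Pred C a\<rbrakk> \<Longrightarrow>
          ConnOp C k a ps \<in> Pred C a"
    and conn_hom: "\<lbrakk>a \<in> Obj C; b \<in> Obj C; f \<in> Hom C a b; conns LL k = Some (length ps);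
          set ps \<subseteq> Pred C b\<rbrakk> \<Longrightarrow>
          Reindex C a b f (ConnOp C k b ps) = ConnOp C k a (map (Reindex C a b f) ps)"
    and eq_pred: "c \<in> Obj C \<Longrightarrow> EqP C c \<in> Pred C (Prd C c c)"
    and qnt_pred: "\<lbrakk>Q \<in> quants LL; b \<in> Obj C; c \<in> Obj C; p \<in> Pred C (Prd C b c)\<rbrakk> \<Longrightarrow>
          QntOp C Q b c p \<in> Pred C b"
    and qnt_natural: "\<lbrakk>Q \<in> quants LL; a \<in> Obj C; b \<in> Obj C; c \<in> Obj C; f \<in> Hom C a b;
          p \<in> Pred C (Prd C b c)\<rbrakk> \<Longrightarrow>
          QntOp C Q a c (Reindex C (Prd C a c) (Prd C b c) (times_ide C a b c f) p) =
          Reindex C a b f (QntOp C Q b c p)"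
    and tensor_monoid: "c \<in> Obj C \<Longrightarrow>
          monoid \<lparr>carrier = Pred C c, mult = (\<lambda>p q. ConnOp C (tensor_conn LL) c [p, q]),
                  one = ConnOp C (unit_conn LL) c []\<rparr>"
    and qnt_one: "\<lbrakk>Q \<in> quants LL; b \<in> Obj C; p \<in> Pred C b\<rbrakk> \<Longrightarrow>
          QntOp C Q b (One C) (Reindex C (Prd C b (One C)) b (Fst C b (One C)) p) = p"
    and qnt_prd: "\<lbrakk>Q \<in> quants LL; b \<in> Obj C; c \<in> Obj C; d \<in> Obj C;
          p \<in> Pred C (Prd C (Prd C b c) d)\<rbrakk> \<Longrightarrow>
          QntOp C Q b (Prd C c d)
            (Reindex C (Prd C b (Prd C c d)) (Prd C (Prd C b c) d) (reassoc C b c d) p) =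
          QntOp C Q b c (QntOp C Q (Prd C b c) d p)"
    and eq_one: "EqP C (One C) = ConnOp C (unit_conn LL) (Prd C (One C) (One C)) []"
    and eq_prd: "\<lbrakk>a \<in> Obj C; b \<in> Obj C\<rbrakk> \<Longrightarrow>
          EqP C (Prd C a b) =
          (let c = Prd C a b in
           ConnOp C (tensor_conn LL) (Prd C c c)
             [Reindex C (Prd C c c) (Prd C a a) (square C c a (Fst C a b)) (EqP C a),
              Reindex C (Prd C c c) (Prd C b b) (square C c b (Snd C a b)) (EqP C b)])"


section \<open>The classifying prop-category of a theory\<close>

text \<open>The theories considered here are closed under a logic, so that being provable from \<open>T\<close> is
  membership in \<open>T\<close>.\<close>

definition term_eq :: "('q, 'c, 's, 'f, 'r) assertion set \<Rightarrow> 's ctx \<Rightarrow> 's \<Rightarrow> 'f trm rel" where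
  "term_eq T \<Gamma> \<sigma> = {(M, M'). Equation \<Gamma> M M' \<sigma> \<in> T}"

definition fm_eq :: "('q, 'c, 's, 'f, 'r) assertion set \<Rightarrow> 's ctx \<Rightarrow> ('q, 'c, 's, 'f, 'r) fm rel" where
  "fm_eq T \<Gamma> = {(\<phi>, \<psi>). Sequent \<Gamma> [\<phi>] \<psi> \<in> T \<and> Sequent \<Gamma> [\<psi>] \<phi> \<in> T}"

definition terms :: "('s, 'f, 'r) signature \<Rightarrow> 's ctx \<Rightarrow> 's \<Rightarrow> 'f trm set" where
  "terms Sg \<Gamma> \<sigma> = {M. has_sort Sg \<Gamma> M \<sigma>}"

definition fms :: "('q, 'c) lang \<Rightarrow> ('s, 'f, 'r) signature \<Rightarrow> 's ctx \<Rightarrow>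
    ('q, 'c, 's, 'f, 'r) fm set" where
  "fms LL Sg \<Gamma> = {\<phi>. wf_fm LL Sg \<Gamma> \<phi>}"

definition rep :: "'a set \<Rightarrow> 'a" where
  "rep X = (SOME x. x \<in> X)"

definition fm_class :: "('q, 'c, 's, 'f, 'r) assertion set \<Rightarrow> 's ctx \<Rightarrow>
    ('q, 'c, 's, 'f, 'r) fm \<Rightarrow> ('q, 'c, 's, 'f, 'r) fm set" where
  "fm_class T \<Gamma> \<phi> = fm_eq T \<Gamma> `` {\<phi>}"

text \<open>The morphism \<open>\<Gamma> \<rightarrow> \<Delta>\<close> given by a list of terms over \<open>\<Gamma>\<close>, one for each variable of \<open>\<Delta>\<close>.\<close>

definition mor_class :: "('q, 'c, 's, 'f, 'r) assertion set \<Rightarrow> 's ctx \<Rightarrow> 's ctx \<Rightarrow>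
    'f trm list \<Rightarrow> 'f trm set list" where
  "mor_class T \<Gamma> \<Delta> Ms = map2 (\<lambda>\<sigma> M. term_eq T \<Gamma> \<sigma> `` {M}) \<Delta> Ms"

text \<open>\<open>qnt_iter Q \<Delta>\<close> quantifies the variables of \<open>\<Delta>\<close>, the one declared last innermost.\<close>

fun qnt_iter :: "'q \<Rightarrow> 's ctx \<Rightarrow> ('q, 'c, 's, 'f, 'r) fm \<Rightarrow> ('q, 'c, 's, 'f, 'r) fm" where
  "qnt_iter Q [] \<phi> = \<phi>"
| "qnt_iter Q (\<sigma> # \<Delta>) \<phi> = qnt_iter Q \<Delta> (Qnt Q \<sigma> \<phi>)"

fun tensor_list :: "('q, 'c) lang \<Rightarrow> ('q, 'c, 's, 'f, 'r) fm list \<Rightarrow> ('q, 'c, 's, 'f, 'r) fm" where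
  "tensor_list LL [] = unit_fm LL"
| "tensor_list LL [\<phi>] = \<phi>"
| "tensor_list LL (\<phi> # \<psi> # \<phi>s) = tensor LL \<phi> (tensor_list LL (\<psi> # \<phi>s))"

text \<open>Over \<open>\<Gamma> \<times> \<Gamma>\<close>, the variable at position \<open>i\<close> of the first and of the second copy of \<open>\<Gamma>\<close> is
  \<open>Var (length \<Gamma> + i)\<close> and \<open>Var i\<close>. The list is reversed to start with the variable declared first.\<close>

definition eq_fm :: "('q, 'c) lang \<Rightarrow> 's ctx \<Rightarrow> ('q, 'c, 's, 'f, 'r) fm" where
  "eq_fm LL \<Gamma> =
     tensor_list LL (rev (map (\<lambda>i. Eql (\<Gamma> ! i) (Var (length \<Gamma> + i)) (Var i)) [0..<length \<Gamma>]))"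

definition classifying :: "('q, 'c) lang \<Rightarrow> ('s, 'f, 'r) signature \<Rightarrow>
    ('q, 'c, 's, 'f, 'r) assertion set \<Rightarrow>
    ('s ctx, 'f trm set list, ('q, 'c, 's, 'f, 'r) fm set, 'q, 'c) fa_cat" where
  "classifying LL Sg T =
    \<lparr>Obj = {\<Gamma>. is_ctx Sg \<Gamma>},
     Hom = (\<lambda>\<Gamma> \<Delta>. {Xs. list_all2 (\<lambda>X \<sigma>. X \<in> terms Sg \<Gamma> \<sigma> // term_eq T \<Gamma> \<sigma>) Xs \<Delta>}),
     Ide = (\<lambda>\<Gamma>. mor_class T \<Gamma> \<Gamma> (map Var [0..<length \<Gamma>])),
     Cmp = (\<lambda>\<Gamma> \<Delta> \<Theta> Ys Xs. mor_class T \<Gamma> \<Theta> (map (subst (inst (map rep Xs))) (map rep Ys))),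
     One = [],
     Prd = (\<lambda>\<Gamma> \<Delta>. \<Delta> @ \<Gamma>),
     Fst = (\<lambda>\<Gamma> \<Delta>. mor_class T (\<Delta> @ \<Gamma>) \<Gamma> (map Var [length \<Delta>..<length \<Delta> + length \<Gamma>])),
     Snd = (\<lambda>\<Gamma> \<Delta>. mor_class T (\<Delta> @ \<Gamma>) \<Delta> (map Var [0..<length \<Delta>])),
     Pred = (\<lambda>\<Gamma>. fms LL Sg \<Gamma> // fm_eq T \<Gamma>),
     Leq = (\<lambda>\<Gamma>. {(A, B). A \<in> fms LL Sg \<Gamma> // fm_eq T \<Gamma> \<and> B \<in> fms LL Sg \<Gamma> // fm_eq T \<Gamma> \<and>
                         Sequent \<Gamma> [rep A] (rep B) \<in> T}),
     Reindex = (\<lambda>\<Gamma> \<Delta> Xs A. fm_class T \<Gamma> (fsubst (inst (map rep Xs)) (rep A))),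
     ConnOp = (\<lambda>k \<Gamma> As. fm_class T \<Gamma> (Conn k (map rep As))),
     QntOp = (\<lambda>Q \<Gamma> \<Delta> A. fm_class T \<Gamma> (qnt_iter Q \<Delta> (rep A))),
     EqP = (\<lambda>\<Gamma>. fm_class T (\<Gamma> @ \<Gamma>) (eq_fm LL \<Gamma>))\<rparr>"

text \<open>The record above computes with chosen representatives. Well-definedness says that the two
  relations are equivalences and that no operation depends on the choice.\<close>

definition mor_eq :: "('q, 'c, 's, 'f, 'r) assertion set \<Rightarrow> 's ctx \<Rightarrow> 's ctx \<Rightarrow>
    'f trm list \<Rightarrow> 'f trm list \<Rightarrow> bool" where
  "mor_eq T \<Gamma> \<Delta> Ms Ms' \<longleftrightarrow> length Ms = length \<Delta> \<and> length Ms' = length \<Delta> \<and>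
     (\<forall>i < length \<Delta>. (Ms ! i, Ms' ! i) \<in> term_eq T \<Gamma> (\<Delta> ! i))"

locale classifying_well_defined =
  fixes LL :: "('q, 'c) lang" and Sg :: "('s, 'f, 'r) signature"
    and T :: "('q, 'c, 's, 'f, 'r) assertion set"
  assumes term_equiv: "\<lbrakk>is_ctx Sg \<Gamma>; \<sigma> \<in> sorts Sg\<rbrakk> \<Longrightarrow> equiv (terms Sg \<Gamma> \<sigma>) (term_eq T \<Gamma> \<sigma>)"
    and fm_equiv: "is_ctx Sg \<Gamma> \<Longrightarrow> equiv (fms LL Sg \<Gamma>) (fm_eq T \<Gamma>)"
    and cmp_cong: "\<lbrakk>is_ctx Sg \<Gamma>; is_ctx Sg \<Delta>; is_ctx Sg \<Theta>; mor_eq T \<Gamma> \<Delta> Ms Ms'; mor_eq T \<Delta> \<Theta> Ns Ns'\<rbrakk> \<Longrightarrow>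
          mor_eq T \<Gamma> \<Theta> (map (subst (inst Ms)) Ns) (map (subst (inst Ms')) Ns')"
    and leq_cong: "\<lbrakk>is_ctx Sg \<Gamma>; (\<phi>, \<phi>') \<in> fm_eq T \<Gamma>; (\<psi>, \<psi>') \<in> fm_eq T \<Gamma>\<rbrakk> \<Longrightarrow>
          Sequent \<Gamma> [\<phi>] \<psi> \<in> T \<longleftrightarrow> Sequent \<Gamma> [\<phi>'] \<psi>' \<in> T"
    and reindex_cong: "\<lbrakk>is_ctx Sg \<Gamma>; is_ctx Sg \<Delta>; mor_eq T \<Gamma> \<Delta> Ms Ms'; (\<phi>, \<phi>') \<in> fm_eq T \<Delta>\<rbrakk> \<Longrightarrow>
          (fsubst (inst Ms) \<phi>, fsubst (inst Ms') \<phi>') \<in> fm_eq T \<Gamma>"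
    and conn_cong: "\<lbrakk>is_ctx Sg \<Gamma>; conns LL k = Some (length \<phi>s);
          list_all2 (\<lambda>\<phi> \<phi>'. (\<phi>, \<phi>') \<in> fm_eq T \<Gamma>) \<phi>s \<phi>s'\<rbrakk> \<Longrightarrow>
          (Conn k \<phi>s, Conn k \<phi>s') \<in> fm_eq T \<Gamma>"
    and qnt_cong: "\<lbrakk>is_ctx Sg \<Gamma>; is_ctx Sg \<Delta>; Q \<in> quants LL; (\<phi>, \<phi>') \<in> fm_eq T (\<Delta> @ \<Gamma>)\<rbrakk> \<Longrightarrow>
          (qnt_iter Q \<Delta> \<phi>, qnt_iter Q \<Delta> \<phi>') \<in> fm_eq T \<Gamma>"

definition adequate :: "('q, 'c) lang \<Rightarrow> ('q, 'c, 's, 'f, 'r) logic \<Rightarrow> bool" where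
  "adequate LL L \<longleftrightarrow>
     (\<forall>Sg T. wf_sig Sg \<and> is_theory_of LL L Sg T \<longrightarrow>
        classifying_well_defined LL Sg T \<and> FA_object LL (classifying LL Sg T))"

end

(* The only delicate point is that the rules substitute for one variable at a time, and that typed
   equational logic has no weakening rule. To substitute terms over a context Gamma for all variables
   of Delta at once, first weaken from Delta to Delta, Gamma. There the variables of Delta are free to be
   replaced one after the other by terms over Gamma alone, which no later replacement affects.
   Weakening of an equation M = M' is the instance of the substitution rule that substitutes M and M'
   for x in x = x. Everything else is a computation with representatives: the chosen finite products
   concatenate contexts, so reassociation is an identity and iterated quantification composes, and the
   two-way rules for the tensor and the unit give the monoid laws. *)

theory Submission
  imports Defs
begin

section \<open>Substitution\<close>

text \<open>In nameless form the weakened context is \<open>\<Gamma> @ \<Delta>\<close>: \<Gamma> is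
  declared last and holds the smallest indices. Always replacing position
  \<open>length \<Gamma>\<close> then uses up \<Delta> from its head, while the inserted terms keep
  their indices. The record \<open>classifying\<close> applies \<open>rep\<close> in nearly every
  operation. Each congruence property therefore becomes a rule saying that the operation, applied to
  classes of given terms or formulas, is the class of the syntactic operation. As every morphism and
  predicate is such a class, each axiom reduces to an identity of substitutions or to an
  interderivability. The identities hold only on the variables of the context in question, because
  \<open>inst\<close> and its relatives take default values elsewhere. This is why the congruence
  lemmas for substitution carry sorts. Cut is available only between sequents with a single
  antecedent, so it cannot replace a formula inside a list. The monoid laws are obtained instead by
  comparing the consequences of the two sides.\<close>

lemma subst_Var [simp]: "subst Var M = M"
  by (induction M) (auto simp: map_idI)

lemma subst_subst: "subst s (subst t M) = subst (\<lambda>i. subst s (t i)) M"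
  by (induction M) auto

text \<open>Discards the default values that \<open>inst\<close> and \<open>inst_at\<close> take
  outside the intended context: a sorted term contains no such variable.\<close>

lemma subst_cong:
  assumes "has_sort Sg \<Gamma> M \<sigma>" and "\<And>i. i < length \<Gamma> \<Longrightarrow> s i = t i"
  shows "subst s M = subst t M"
  using assms(1)
proof induction
  case (Fn f \<sigma>s \<tau> ts)
  then show ?case by (auto simp: list_all2_conv_all_nth in_set_conv_nth)
qed (simp add: assms(2))

lemma has_sort_subst:
  assumes "has_sort Sg \<Delta> M \<sigma>" and "\<And>i. i < length \<Delta> \<Longrightarrow> has_sort Sg \<Gamma> (s i) (\<Delta> ! i)"
  shows "has_sort Sg \<Gamma> (subst s M) \<sigma>"
  using assms(1)
proof induction
  case (Fn f \<sigma>s \<tau> ts)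
  then show ?case by (auto simp: list_all2_conv_all_nth intro!: has_sort.Fn)
qed (simp add: assms(2))

lemma lift_Var [simp]: "lift Var = Var"
  by (auto simp: fun_eq_iff lift_def split: nat.split)

text \<open>Shifting and then applying \<open>lift s\<close> agrees with applying \<open>s\<close>
  and then shifting. This is the quantifier case of \<open>fsubst_fsubst\<close>.\<close>

lemma subst_lift_lift: "subst (lift s) (lift t i) = lift (\<lambda>i. subst s (t i)) i"
  by (auto simp: lift_def subst_subst split: nat.split)

lemma fsubst_Var [simp]: "fsubst Var \<phi> = \<phi>"
  by (induction \<phi>) (auto simp: map_idI)

lemma fsubst_fsubst: "fsubst s (fsubst t \<phi>) = fsubst (\<lambda>i. subst s (t i)) \<phi>"
  by (induction \<phi> arbitrary: s t) (auto simp: subst_subst subst_lift_lift)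

lemma fsubst_cong:
  assumes "wf_fm LL Sg \<Gamma> \<phi>" and "\<And>i. i < length \<Gamma> \<Longrightarrow> s i = t i"
  shows "fsubst s \<phi> = fsubst t \<phi>"
  using assms
proof (induction arbitrary: s t)
  case (Rel r \<sigma>s \<Gamma> ts)
  then have "subst s (ts ! i) = subst t (ts ! i)" if "i < length ts" for i
    using that subst_cong[of Sg \<Gamma> "ts ! i" "\<sigma>s ! i" s t] by (simp add: list_all2_conv_all_nth)
  then show ?case by (auto simp: in_set_conv_nth)
next
  case (Eql \<sigma> \<Gamma> M N)
  then show ?case by (auto intro: subst_cong)
next
  case (Qnt Q \<sigma> \<Gamma> \<phi>)
  have "lift s i = lift t i" if "i < length (\<sigma> # \<Gamma>)" for i
    using Qnt.prems that by (cases i) (simp_all add: lift_def)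
  then have "fsubst (lift s) \<phi> = fsubst (lift t) \<phi>" by (rule Qnt.IH)
  then show ?case by simp
next
  case (Conn c \<phi>s \<Gamma>)
  then have "fsubst s \<phi> = fsubst t \<phi>" if "\<phi> \<in> set \<phi>s" for \<phi>
    using that by blast
  then show ?case by simp
qed

lemma has_sort_lift:
  assumes "\<And>i. i < length \<Delta> \<Longrightarrow> has_sort Sg \<Gamma> (s i) (\<Delta> ! i)" and "i < length (\<sigma> # \<Delta>)"
  shows "has_sort Sg (\<sigma> # \<Gamma>) (lift s i) ((\<sigma> # \<Delta>) ! i)"
proof (cases i)
  case 0
  then show ?thesis using has_sort.Var[of 0 "\<sigma> # \<Gamma>" Sg] by (simp add: lift_def)
next
  case (Suc j)
  have "has_sort Sg (\<sigma> # \<Gamma>) (Var (Suc i)) (\<Gamma> ! i)" if "i < length \<Gamma>" for i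
    using has_sort.Var[of "Suc i" "\<sigma> # \<Gamma>" Sg] that by simp
  then show ?thesis
    using Suc assms has_sort_subst[of Sg \<Gamma> "s j"] by (simp add: lift_def)
qed

lemma wf_fm_fsubst:
  assumes "wf_fm LL Sg \<Delta> \<phi>" and "\<And>i. i < length \<Delta> \<Longrightarrow> has_sort Sg \<Gamma> (s i) (\<Delta> ! i)"
  shows "wf_fm LL Sg \<Gamma> (fsubst s \<phi>)"
  using assms
proof (induction arbitrary: s \<Gamma>)
  case (Rel r \<sigma>s \<Delta> ts)
  then show ?case by (auto simp: list_all2_conv_all_nth intro!: wf_fm.Rel has_sort_subst)
next
  case (Eql \<sigma> \<Delta> M N)
  then show ?case by (auto intro!: wf_fm.Eql has_sort_subst)
next
  case (Conn c \<phi>s \<Delta>)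
  then show ?case by (auto intro!: wf_fm.Conn)
next
  case (Qnt Q \<sigma> \<Delta> \<phi>)
  then show ?case using has_sort_lift[of \<Delta> Sg \<Gamma> s]  by (auto intro!: wf_fm.Qnt)
qed

section \<open>Substitution under iterated quantifiers\<close>

lemma fsubst_qnt_iter:
  "fsubst s (qnt_iter Q \<Delta> \<phi>) = qnt_iter Q \<Delta> (fsubst ((lift ^^ length \<Delta>) s) \<phi>)"
  by (induction \<Delta> arbitrary: \<phi>) (auto simp: funpow_swap1)

text \<open>A closed form of the substitution met under \<open>n\<close> binders, to be compared
  entry by entry with the term list of a product morphism in the naturality of quantifiers.\<close>

lemma funpow_lift:
  "(lift ^^ n) s i = (if i < n then Var i else subst (\<lambda>k. Var (n + k)) (s (i - n)))"
proof (induction n arbitrary: i)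
  case (Suc n)
  show ?case
  proof (cases i)
    case 0
    then show ?thesis by (simp add: lift_def)
  next
    case (Suc j)
    then show ?thesis using Suc.IH[of j] by (simp add: lift_def[of "(lift ^^ n) s"] subst_subst)
  qed
qed simp

text \<open>The head of a context is declared last and quantified innermost, so the variables of
  \<Delta> are bound inside those of \<Gamma>.\<close>

lemma qnt_iter_append: "qnt_iter Q (\<Delta> @ \<Gamma>) \<phi> = qnt_iter Q \<Gamma> (qnt_iter Q \<Delta> \<phi>)"
  by (induction \<Delta> arbitrary: \<phi>) auto

lemma fsubst_tensor_list: "fsubst s (tensor_list LL \<phi>s) = tensor_list LL (map (fsubst s) \<phi>s)"
  by (induction LL \<phi>s rule: tensor_list.induct) auto

section \<open>Sorts of terms under a change of context\<close>

lemma has_sort_sorts: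
  assumes "wf_sig Sg" "is_ctx Sg \<Gamma>" "has_sort Sg \<Gamma> M \<sigma>"
  shows "\<sigma> \<in> sorts Sg"
  using assms(3,1,2) by cases (auto simp: wf_sig_def is_ctx_def)

text \<open>Earlier declarations are appended at the end and leave the indices of \<Gamma> alone, so
  the term needs no shift; contrast \<open>has_sort_shift\<close>.\<close>

lemma has_sort_append:
  assumes "has_sort Sg \<Gamma> M \<sigma>"
  shows "has_sort Sg (\<Gamma> @ \<Delta>) M \<sigma>"
proof -
  have "has_sort Sg (\<Gamma> @ \<Delta>) (subst Var M) \<sigma>"
    using assms
  proof (rule has_sort_subst)
    fix i assume "i < length \<Gamma>"
    then show "has_sort Sg (\<Gamma> @ \<Delta>) (Var i) (\<Gamma> ! i)"
      using has_sort.Var[of i "\<Gamma> @ \<Delta>" Sg] by (simp add: nth_append)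
  qed
  then show ?thesis by simp
qed

lemma has_sort_sub_at:
  assumes "has_sort Sg (\<Gamma>' @ \<Gamma>) M \<sigma>" and "i < length (\<Gamma>' @ \<sigma> # \<Gamma>)"
  shows "has_sort Sg (\<Gamma>' @ \<Gamma>) (sub_at (length \<Gamma>') M i) ((\<Gamma>' @ \<sigma> # \<Gamma>) ! i)"
proof -
  consider "i < length \<Gamma>'" | "i = length \<Gamma>'" | j where "i = Suc (length \<Gamma>' + j)" "j < length \<Gamma>"
  proof (cases i "length \<Gamma>'" rule: linorder_cases)
    case greater
    then have "i = Suc (length \<Gamma>' + (i - Suc (length \<Gamma>')))" "i - Suc (length \<Gamma>') < length \<Gamma>"
      using assms(2) by auto
    then show thesis by (rule that(3))
  qed
  then show ?thesis
  proof cases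
    case 1
    then show ?thesis using has_sort.Var[of i "\<Gamma>' @ \<Gamma>" Sg] by (simp add: sub_at_def nth_append)
  next
    case 2
    then show ?thesis using assms by (simp add: sub_at_def)
  next
    case 3
    then show ?thesis using has_sort.Var[of "i - 1" "\<Gamma>' @ \<Gamma>" Sg]
      by (simp add: sub_at_def nth_append)
  qed
qed

lemma has_sort_rename:
  assumes "subctx \<rho> \<Delta> \<Gamma>" "has_sort Sg \<Delta> M \<sigma>"
  shows "has_sort Sg \<Gamma> (subst (Var \<circ> \<rho>) M) \<sigma>"
  using assms(2)
proof (rule has_sort_subst)
  fix i assume "i < length \<Delta>"
  then show "has_sort Sg \<Gamma> ((Var \<circ> \<rho>) i) (\<Delta> ! i)"
    using assms(1) has_sort.Var[of "\<rho> i" \<Gamma> Sg] by (auto simp: subctx_def)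
qed

lemma has_sort_shift:
  assumes "i < length \<Delta>"
  shows "has_sort Sg (\<Gamma> @ \<Delta>) (Var (length \<Gamma> + i)) (\<Delta> ! i)"
  using has_sort.Var[of "length \<Gamma> + i" "\<Gamma> @ \<Delta>" Sg] assms by simp

lemma has_sort_inst:
  assumes "list_all2 (has_sort Sg \<Gamma>) Ms \<Delta>" and "i < length \<Delta>"
  shows "has_sort Sg \<Gamma> (inst Ms i) (\<Delta> ! i)"
  using assms by (simp add: inst_def list_all2_conv_all_nth)

text \<open>\<open>inst_at k Ms\<close> replaces the block of \<open>length Ms\<close> variables that starts at position \<open>k\<close>; it is
  an iteration of \<open>sub_at k\<close>.\<close>

definition inst_at :: "nat \<Rightarrow> 'f trm list \<Rightarrow> nat \<Rightarrow> 'f trm" where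
  "inst_at k Ms i =
     (if i < k then Var i else if i < k + length Ms then Ms ! (i - k) else Var (i - length Ms))"

lemma inst_at_Nil [simp]: "inst_at k [] = Var"
  by (auto simp: inst_at_def fun_eq_iff)

text \<open>Only indices below \<open>length \<Gamma>\<close> occur in \<open>M\<close>, and
  \<open>inst_at\<close> fixes these. Removing the variable at \<open>length \<Gamma>\<close> moves
  the next one of the block into its place, so the remaining terms act at the same position.\<close>

lemma subst_inst_at_sub_at:
  assumes "has_sort Sg \<Gamma> M \<sigma>"
  shows "subst (inst_at (length \<Gamma>) Ms) (sub_at (length \<Gamma>) M i) = inst_at (length \<Gamma>) (M # Ms) i"
proof -
  have "subst (inst_at (length \<Gamma>) Ms) M = subst Var M"
    using assms by (rule subst_cong) (simp add: inst_at_def)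
  then show ?thesis
    by (auto simp: sub_at_def inst_at_def nth_Cons')
qed


section \<open>Theories closed under the rules\<close>

text \<open>All that is used of the logic: its theories are closed under rule instances. The
  premises are well-formed because they lie in \<open>T\<close>, which leaves only the conclusion to
  be checked.\<close>

locale closed_theory =
  fixes LL :: "('q, 'c) lang" and Sg :: "('s, 'f, 'r) signature"
    and T :: "('q, 'c, 's, 'f, 'r) assertion set"
  assumes wf_lang: "wf_lang LL" and wf_sig: "wf_sig Sg"
    and T_wf: "T \<subseteq> assertions LL Sg"
    and eq_closed: "\<lbrakk>equational_rule A a; A \<subseteq> T; wf_assertion LL Sg a\<rbrakk> \<Longrightarrow> a \<in> T"
    and Lm_closed: "\<lbrakk>Lm_rule LL A a; A \<subseteq> T; wf_assertion LL Sg a\<rbrakk> \<Longrightarrow> a \<in> T"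
begin

lemma wf_T: "a \<in> T \<Longrightarrow> wf_assertion LL Sg a"
  using T_wf by (auto simp: assertions_def)

lemma wf_tensor [intro]:
  "\<lbrakk>wf_fm LL Sg \<Gamma> \<phi>; wf_fm LL Sg \<Gamma> \<psi>\<rbrakk> \<Longrightarrow> wf_fm LL Sg \<Gamma> (tensor LL \<phi> \<psi>)"
  using wf_lang by (auto simp: wf_lang_def intro!: wf_fm.Conn)

lemma wf_unit [intro, simp]: "wf_fm LL Sg \<Gamma> (unit_fm LL)"
  using wf_lang by (auto simp: wf_lang_def intro!: wf_fm.Conn)


subsection \<open>Simultaneous substitution\<close>

text \<open>The change of context is hidden in the side condition of the substitution rule, whose
  first premise may live over a part of the remaining context. The second premise is a reflexivity
  over \<Gamma> with one fresh variable declared last, hence \<open>Var 0\<close>.\<close>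

lemma equation_rename:
  assumes "Equation \<Delta> M M' \<sigma> \<in> T" "is_ctx Sg \<Gamma>" "subctx \<rho> \<Delta> \<Gamma>"
  shows "Equation \<Gamma> (subst (Var \<circ> \<rho>) M) (subst (Var \<circ> \<rho>) M') \<sigma> \<in> T"
proof -
  have wf: "is_ctx Sg \<Delta>" "has_sort Sg \<Delta> M \<sigma>" "has_sort Sg \<Delta> M' \<sigma>"
    using wf_T[OF assms(1)] by auto
  then have "is_ctx Sg (\<sigma> # \<Gamma>)"
    using has_sort_sorts[OF wf_sig] assms(2) by (auto simp: is_ctx_def)
  moreover have "has_sort Sg (\<sigma> # \<Gamma>) (Var 0) \<sigma>"
    using has_sort.Var[of 0 "\<sigma> # \<Gamma>" Sg] by simp
  ultimately have "Equation (\<sigma> # \<Gamma>) (Var 0) (Var 0) \<sigma> \<in> T"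
    by (intro eq_closed[OF equational_rule.Refl]) auto
  then show ?thesis
    using eq_closed[OF equational_rule.Subst[of \<rho> \<Delta> "[]" \<Gamma> M M' \<sigma> "Var 0" "Var 0" \<sigma>]]
      assms wf by (auto simp: sub_at_def has_sort_rename)
qed

lemma subctx_append: "subctx id \<Gamma> (\<Gamma> @ \<Delta>)"
  by (auto simp: subctx_def nth_append)

lemma equation_inst_at:
  assumes "Equation (\<Gamma> @ \<Delta>) N N' \<tau> \<in> T" "mor_eq T \<Gamma> \<Delta> Ms Ms'"
  shows "Equation \<Gamma> (subst (inst_at (length \<Gamma>) Ms) N) (subst (inst_at (length \<Gamma>) Ms') N') \<tau> \<in> T"
  using assms
proof (induction \<Delta> arbitrary: Ms Ms' N N')
  case Nil
  then show ?case by (simp add: mor_eq_def)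
next
  case (Cons \<sigma> \<Delta>)
  from Cons.prems(2) obtain M Ms0 M' Ms0' where Ms: "Ms = M # Ms0" "Ms' = M' # Ms0'"
    and M: "Equation \<Gamma> M M' \<sigma> \<in> T" and Ms0: "mor_eq T \<Gamma> \<Delta> Ms0 Ms0'"
    by (cases Ms; cases Ms') (force simp: mor_eq_def term_eq_def nth_Cons')+
  have wfM: "has_sort Sg \<Gamma> M \<sigma>" "has_sort Sg \<Gamma> M' \<sigma>"
    using wf_T[OF M] by auto
  let ?N = "subst (sub_at (length \<Gamma>) M) N" and ?N' = "subst (sub_at (length \<Gamma>) M') N'"
  \<comment> \<open>The head of \<open>\<sigma> # \<Delta>\<close> sits at position
    \<open>length \<Gamma>\<close>, with \<Gamma> as the declarations after it. The side condition
    holds with \<open>id\<close>, so the equation between \<open>M\<close> and \<open>M'\<close>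
    enters over \<Gamma> itself.\<close>
  have "Equation (\<Gamma> @ \<Delta>) ?N ?N' \<tau> \<in> T"
    using eq_closed[OF equational_rule.Subst[OF subctx_append[of \<Gamma> \<Delta>], of M M' \<sigma> N N' \<tau>]] M
      Cons.prems(1) wf_T[OF Cons.prems(1)] wfM
    by (auto simp: is_ctx_def intro!: has_sort_subst[where \<Delta> = "\<Gamma> @ \<sigma> # \<Delta>"]
        has_sort_sub_at[OF has_sort_append])
  from Cons.IH[OF this Ms0] show ?case
    by (simp add: subst_subst Ms subst_inst_at_sub_at[OF wfM(1)] subst_inst_at_sub_at[OF wfM(2)])
qed

text \<open>The rule \<open>Sub\<close> puts \<open>M\<close> into the antecedent and
  \<open>M'\<close> into the succedent, so one induction yields both closure under substitution and
  replacement of equals.\<close>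

lemma sequent_inst_at:
  assumes "Sequent (\<Gamma> @ \<Delta>) [\<phi>] \<psi> \<in> T" "mor_eq T \<Gamma> \<Delta> Ms Ms'"
  shows "Sequent \<Gamma> [fsubst (inst_at (length \<Gamma>) Ms) \<phi>] (fsubst (inst_at (length \<Gamma>) Ms') \<psi>) \<in> T"
  using assms
proof (induction \<Delta> arbitrary: Ms Ms' \<phi> \<psi>)
  case Nil
  then show ?case by (simp add: mor_eq_def)
next
  case (Cons \<sigma> \<Delta>)
  from Cons.prems(2) obtain M Ms0 M' Ms0' where Ms: "Ms = M # Ms0" "Ms' = M' # Ms0'"
    and M: "Equation \<Gamma> M M' \<sigma> \<in> T" and Ms0: "mor_eq T \<Gamma> \<Delta> Ms0 Ms0'"
    by (cases Ms; cases Ms') (force simp: mor_eq_def term_eq_def nth_Cons')+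
  have wfM: "has_sort Sg \<Gamma> M \<sigma>" "has_sort Sg \<Gamma> M' \<sigma>"
    using wf_T[OF M] by auto
  let ?\<phi> = "fsubst (sub_at (length \<Gamma>) M) \<phi>" and ?\<psi> = "fsubst (sub_at (length \<Gamma>) M') \<psi>"
  have "Sequent (\<Gamma> @ \<Delta>) [?\<phi>] ?\<psi> \<in> T"
    using Lm_closed[OF Lm_rule.Sub[OF subctx_append[of \<Gamma> \<Delta>], of LL M M' \<sigma> "[\<phi>]" \<psi>]] M
      Cons.prems(1) wf_T[OF Cons.prems(1)] wfM
    by (auto simp: is_ctx_def intro!: wf_fm_fsubst[where \<Delta> = "\<Gamma> @ \<sigma> # \<Delta>"]
        has_sort_sub_at[OF has_sort_append])
  from Cons.IH[OF this Ms0] show ?case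
    by (simp add: fsubst_fsubst Ms subst_inst_at_sub_at[OF wfM(1)] subst_inst_at_sub_at[OF wfM(2)])
qed

lemma equation_weaken:
  assumes "Equation \<Delta> N N' \<tau> \<in> T" "is_ctx Sg \<Gamma>"
  shows "Equation (\<Gamma> @ \<Delta>) (subst (\<lambda>i. Var (length \<Gamma> + i)) N) (subst (\<lambda>i. Var (length \<Gamma> + i)) N') \<tau> \<in> T"
  using equation_rename[OF assms(1), of "\<Gamma> @ \<Delta>" "\<lambda>i. length \<Gamma> + i"] assms(2) wf_T[OF assms(1)]
  by (auto simp: is_ctx_def subctx_def comp_def)

lemma sequent_weaken:
  assumes "Sequent \<Delta> [\<phi>] \<psi> \<in> T" "is_ctx Sg \<Gamma>"
  shows "Sequent (\<Gamma> @ \<Delta>) [fsubst (\<lambda>i. Var (length \<Gamma> + i)) \<phi>] (fsubst (\<lambda>i. Var (length \<Gamma> + i)) \<psi>) \<in> T"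
  using assms(2)
proof (induction \<Gamma>)
  case Nil
  then show ?case using assms(1) by simp
next
  case (Cons \<sigma> \<Gamma>)
  let ?S = "\<lambda>i. Var (Suc i)"
  have *: "Sequent (\<Gamma> @ \<Delta>) [fsubst (\<lambda>i. Var (length \<Gamma> + i)) \<phi>] (fsubst (\<lambda>i. Var (length \<Gamma> + i)) \<psi>) \<in> T"
    using Cons by (simp add: is_ctx_def)
  have "Sequent (\<sigma> # \<Gamma> @ \<Delta>) (map (fsubst ?S) [fsubst (\<lambda>i. Var (length \<Gamma> + i)) \<phi>])
      (fsubst ?S (fsubst (\<lambda>i. Var (length \<Gamma> + i)) \<psi>)) \<in> T"
    using * wf_T[OF *] Cons.prems
    by (intro Lm_closed[OF Lm_rule.Cwk])
      (auto simp: is_ctx_def intro!: wf_fm_fsubst[where \<Delta> = "\<Gamma> @ \<Delta>"]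
        has_sort_shift[where \<Gamma> = "[\<sigma>]", simplified])
  then show ?case by (simp add: fsubst_fsubst)
qed

lemma equation_inst:
  assumes "Equation \<Delta> N N' \<tau> \<in> T" "mor_eq T \<Gamma> \<Delta> Ms Ms'" "is_ctx Sg \<Gamma>"
  shows "Equation \<Gamma> (subst (inst Ms) N) (subst (inst Ms') N') \<tau> \<in> T"
proof -
  \<comment> \<open>The shift moves the variables of \<Delta> onto the block that
    \<open>inst_at\<close> replaces. Beyond \<Delta> the two substitutions may differ, hence
    \<open>subst_cong\<close>.\<close>
  have "subst (inst_at (length \<Gamma>) Ms) (subst (\<lambda>i. Var (length \<Gamma> + i)) N) = subst (inst Ms) N"
    "subst (inst_at (length \<Gamma>) Ms') (subst (\<lambda>i. Var (length \<Gamma> + i)) N') = subst (inst Ms') N'"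
    using assms(2) wf_T[OF assms(1)]
    by (auto simp: subst_subst inst_at_def inst_def mor_eq_def intro!: subst_cong[of Sg \<Delta>])
  with equation_inst_at[OF equation_weaken[OF assms(1,3)] assms(2)] show ?thesis by simp
qed

lemma sequent_inst:
  assumes "Sequent \<Delta> [\<phi>] \<psi> \<in> T" "mor_eq T \<Gamma> \<Delta> Ms Ms'" "is_ctx Sg \<Gamma>"
  shows "Sequent \<Gamma> [fsubst (inst Ms) \<phi>] (fsubst (inst Ms') \<psi>) \<in> T"
proof -
  have "fsubst (inst_at (length \<Gamma>) Ms) (fsubst (\<lambda>i. Var (length \<Gamma> + i)) \<phi>) = fsubst (inst Ms) \<phi>"
    "fsubst (inst_at (length \<Gamma>) Ms') (fsubst (\<lambda>i. Var (length \<Gamma> + i)) \<psi>) = fsubst (inst Ms') \<psi>"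
    using assms(2) wf_T[OF assms(1)]
    by (auto simp: fsubst_fsubst inst_at_def inst_def mor_eq_def intro!: fsubst_cong[of LL Sg \<Delta>])
  with sequent_inst_at[OF sequent_weaken[OF assms(1,3)] assms(2)] show ?thesis by simp
qed

section \<open>Provable equality and interderivability as congruences\<close>

lemma equiv_term_eq:
  assumes "is_ctx Sg \<Gamma>"
  shows "equiv (terms Sg \<Gamma> \<sigma>) (term_eq T \<Gamma> \<sigma>)"
proof (rule equivI)
  show "term_eq T \<Gamma> \<sigma> \<subseteq> terms Sg \<Gamma> \<sigma> \<times> terms Sg \<Gamma> \<sigma>"
    using wf_T by (force simp: term_eq_def terms_def)
  show "refl_on (terms Sg \<Gamma> \<sigma>) (term_eq T \<Gamma> \<sigma>)"
    using assms by (auto simp: refl_on_def terms_def term_eq_def intro!: eq_closed[OF equational_rule.Refl])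
  show "sym (term_eq T \<Gamma> \<sigma>)"
    using wf_T by (force simp: sym_def term_eq_def intro!: eq_closed[OF equational_rule.Sym])
  show "trans (term_eq T \<Gamma> \<sigma>)"
  proof (rule transI)
    fix M M' M''
    assume "(M, M') \<in> term_eq T \<Gamma> \<sigma>" "(M', M'') \<in> term_eq T \<Gamma> \<sigma>"
    then show "(M, M'') \<in> term_eq T \<Gamma> \<sigma>"
      using wf_T[of "Equation \<Gamma> M M' \<sigma>"] wf_T[of "Equation \<Gamma> M' M'' \<sigma>"]
        eq_closed[OF equational_rule.Trans[of \<Gamma> M M' \<sigma> M'']] by (simp add: term_eq_def)
  qed
qed

lemma sequent_refl: "\<lbrakk>is_ctx Sg \<Gamma>; wf_fm LL Sg \<Gamma> \<phi>\<rbrakk> \<Longrightarrow> Sequent \<Gamma> [\<phi>] \<phi> \<in> T"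
  by (rule Lm_closed[OF Lm_rule.Ax]) auto

lemma sequent_trans:
  assumes "Sequent \<Gamma> [\<phi>] \<psi> \<in> T" "Sequent \<Gamma> [\<psi>] \<theta> \<in> T"
  shows "Sequent \<Gamma> [\<phi>] \<theta> \<in> T"
  using Lm_closed[OF Lm_rule.Cut[of LL \<Gamma> \<phi> \<psi> \<theta>]] assms wf_T[OF assms(1)] wf_T[OF assms(2)] by simp

lemma equiv_fm_eq:
  assumes "is_ctx Sg \<Gamma>"
  shows "equiv (fms LL Sg \<Gamma>) (fm_eq T \<Gamma>)"
proof (rule equivI)
  show "fm_eq T \<Gamma> \<subseteq> fms LL Sg \<Gamma> \<times> fms LL Sg \<Gamma>"
    using wf_T by (force simp: fm_eq_def fms_def)
  show "refl_on (fms LL Sg \<Gamma>) (fm_eq T \<Gamma>)"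
    using assms by (auto simp: refl_on_def fms_def fm_eq_def sequent_refl)
  show "sym (fm_eq T \<Gamma>)"
    by (auto simp: sym_def fm_eq_def)
  show "trans (fm_eq T \<Gamma>)"
    by (auto simp: trans_def fm_eq_def intro: sequent_trans)
qed

lemma mor_eq_sym: "\<lbrakk>mor_eq T \<Gamma> \<Delta> Ms Ms'; is_ctx Sg \<Gamma>\<rbrakk> \<Longrightarrow> mor_eq T \<Gamma> \<Delta> Ms' Ms"
  using equiv_term_eq by (auto simp: mor_eq_def equiv_def sym_def)

lemma mor_eq_refl:
  "\<lbrakk>list_all2 (has_sort Sg \<Gamma>) Ms \<Delta>; is_ctx Sg \<Gamma>\<rbrakk> \<Longrightarrow> mor_eq T \<Gamma> \<Delta> Ms Ms"
  using equiv_term_eq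
  by (auto simp: mor_eq_def equiv_def refl_on_def terms_def list_all2_conv_all_nth)

lemma mor_eq_comp:
  "\<lbrakk>is_ctx Sg \<Gamma>; mor_eq T \<Gamma> \<Delta> Ms Ms'; mor_eq T \<Delta> \<Theta> Ns Ns'\<rbrakk> \<Longrightarrow>
    mor_eq T \<Gamma> \<Theta> (map (subst (inst Ms)) Ns) (map (subst (inst Ms')) Ns')"
  using equation_inst by (auto simp: mor_eq_def[of T \<Delta>] mor_eq_def[of T \<Gamma> \<Theta>] term_eq_def)

lemma fm_eq_inst:
  "\<lbrakk>is_ctx Sg \<Gamma>; mor_eq T \<Gamma> \<Delta> Ms Ms'; (\<phi>, \<phi>') \<in> fm_eq T \<Delta>\<rbrakk> \<Longrightarrow>
    (fsubst (inst Ms) \<phi>, fsubst (inst Ms') \<phi>') \<in> fm_eq T \<Gamma>"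
  using sequent_inst mor_eq_sym by (auto simp: fm_eq_def)

lemma fm_eq_wf:
  assumes "(\<phi>, \<psi>) \<in> fm_eq T \<Gamma>"
  shows "wf_fm LL Sg \<Gamma> \<phi>" "wf_fm LL Sg \<Gamma> \<psi>" "is_ctx Sg \<Gamma>"
  using assms wf_T[of "Sequent \<Gamma> [\<phi>] \<psi>"] by (auto simp: fm_eq_def)

lemma fm_eq_trans [trans]:
  "\<lbrakk>(\<phi>, \<psi>) \<in> fm_eq T \<Gamma>; (\<psi>, \<theta>) \<in> fm_eq T \<Gamma>\<rbrakk> \<Longrightarrow> (\<phi>, \<theta>) \<in> fm_eq T \<Gamma>"
  using equiv_fm_eq[OF fm_eq_wf(3)] by (meson equivE transE)

lemma fm_eq_sym: "(\<phi>, \<psi>) \<in> fm_eq T \<Gamma> \<Longrightarrow> (\<psi>, \<phi>) \<in> fm_eq T \<Gamma>"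
  by (simp add: fm_eq_def)

lemma fm_eq_refl: "\<lbrakk>is_ctx Sg \<Gamma>; wf_fm LL Sg \<Gamma> \<phi>\<rbrakk> \<Longrightarrow> (\<phi>, \<phi>) \<in> fm_eq T \<Gamma>"
  by (simp add: fm_eq_def sequent_refl)

lemma fm_eq_Conn:
  assumes "is_ctx Sg \<Gamma>" "conns LL k = Some (length \<phi>s)"
    and eq: "list_all2 (\<lambda>\<phi> \<phi>'. (\<phi>, \<phi>') \<in> fm_eq T \<Gamma>) \<phi>s \<phi>s'"
  shows "(Conn k \<phi>s, Conn k \<phi>s') \<in> fm_eq T \<Gamma>"
proof -
  \<comment> \<open>Stated for arbitrary lists so that it can be used a second time with the two
    lists exchanged.\<close>
  have "Sequent \<Gamma> [Conn k \<phi>s] (Conn k \<phi>s') \<in> T"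
    if "conns LL k = Some (length \<phi>s)" "list_all2 (\<lambda>\<phi> \<phi>'. (\<phi>, \<phi>') \<in> fm_eq T \<Gamma>) \<phi>s \<phi>s'" for \<phi>s \<phi>s'
  proof (rule Lm_closed[OF Lm_rule.Conn_Cong])
    show "length \<phi>s = length \<phi>s'"
      using that(2) by (rule list_all2_lengthD)
    show "(\<Union>i<length \<phi>s. {Sequent \<Gamma> [\<phi>s ! i] (\<phi>s' ! i), Sequent \<Gamma> [\<phi>s' ! i] (\<phi>s ! i)}) \<subseteq> T"
      using that(2) by (auto simp: list_all2_conv_all_nth fm_eq_def)
    show "wf_assertion LL Sg (Sequent \<Gamma> [Conn k \<phi>s] (Conn k \<phi>s'))"
      using that assms(1) fm_eq_wf(1,2)
      by (fastforce simp: list_all2_conv_all_nth in_set_conv_nth intro!: wf_fm.Conn)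
  qed
  from this[OF assms(2) eq] this[of \<phi>s' \<phi>s] show ?thesis
    using assms(2) eq by (auto simp: fm_eq_def list_all2_conv_all_nth)
qed

lemma fm_eq_Qnt:
  assumes "(\<phi>, \<phi>') \<in> fm_eq T (\<sigma> # \<Gamma>)" "Q \<in> quants LL"
  shows "(Qnt Q \<sigma> \<phi>, Qnt Q \<sigma> \<phi>') \<in> fm_eq T \<Gamma>"
proof -
  have "wf_fm LL Sg \<Gamma> (Qnt Q \<sigma> \<phi>)" "wf_fm LL Sg \<Gamma> (Qnt Q \<sigma> \<phi>')" "is_ctx Sg \<Gamma>"
    using fm_eq_wf[OF assms(1)] assms(2) by (auto simp: is_ctx_def intro: wf_fm.Qnt)
  then show ?thesis
    using assms(1) Lm_closed[OF Lm_rule.Quant_Con[of LL \<sigma> \<Gamma> \<phi> \<phi>' Q]]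
      Lm_closed[OF Lm_rule.Quant_Con[of LL \<sigma> \<Gamma> \<phi>' \<phi> Q]]
    by (simp add: fm_eq_def)
qed

lemma fm_eq_qnt_iter:
  "\<lbrakk>(\<phi>, \<phi>') \<in> fm_eq T (\<Delta> @ \<Gamma>); Q \<in> quants LL\<rbrakk> \<Longrightarrow>
    (qnt_iter Q \<Delta> \<phi>, qnt_iter Q \<Delta> \<phi>') \<in> fm_eq T \<Gamma>"
  by (induction \<Delta> arbitrary: \<phi> \<phi>') (auto simp: fm_eq_Qnt)

lemma wf_fm_qnt_iter:
  "\<lbrakk>wf_fm LL Sg (\<Delta> @ \<Gamma>) \<phi>; Q \<in> quants LL; is_ctx Sg \<Delta>\<rbrakk> \<Longrightarrow> wf_fm LL Sg \<Gamma> (qnt_iter Q \<Delta> \<phi>)"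
  by (induction \<Delta> arbitrary: \<phi>) (auto simp: is_ctx_def intro: wf_fm.Qnt)

lemma well_defined: "classifying_well_defined LL Sg T"
proof
  fix \<Gamma> \<phi> \<phi>' \<psi> \<psi>'
  assume "is_ctx Sg \<Gamma>" "(\<phi>, \<phi>') \<in> fm_eq T \<Gamma>" "(\<psi>, \<psi>') \<in> fm_eq T \<Gamma>"
  then show "Sequent \<Gamma> [\<phi>] \<psi> \<in> T \<longleftrightarrow> Sequent \<Gamma> [\<phi>'] \<psi>' \<in> T"
    by (auto simp: fm_eq_def intro: sequent_trans)
qed (auto simp: equiv_term_eq equiv_fm_eq mor_eq_comp fm_eq_inst fm_eq_Conn fm_eq_qnt_iter)


subsection \<open>The tensor product of formulas\<close>

lemma wf_ConnD: "wf_fm LL Sg \<Gamma> (Conn c \<phi>s) \<Longrightarrow> \<forall>\<phi> \<in> set \<phi>s. wf_fm LL Sg \<Gamma> \<phi>"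
  by (cases rule: wf_fm.cases) auto

lemma sequent_tensor:
  "Sequent \<Gamma> (\<Phi> @ tensor LL \<alpha> \<beta> # \<Psi>) \<theta> \<in> T \<longleftrightarrow> Sequent \<Gamma> (\<Phi> @ \<alpha> # \<beta> # \<Psi>) \<theta> \<in> T"
proof
  assume *: "Sequent \<Gamma> (\<Phi> @ tensor LL \<alpha> \<beta> # \<Psi>) \<theta> \<in> T"
  then show "Sequent \<Gamma> (\<Phi> @ \<alpha> # \<beta> # \<Psi>) \<theta> \<in> T"
    using Lm_closed[OF Lm_rule.Tensor_Ref2[of LL \<Gamma> \<Phi> \<alpha> \<beta> \<Psi> \<theta>]] wf_T[OF *]
    by (auto dest: wf_ConnD)
next
  assume *: "Sequent \<Gamma> (\<Phi> @ \<alpha> # \<beta> # \<Psi>) \<theta> \<in> T"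
  then show "Sequent \<Gamma> (\<Phi> @ tensor LL \<alpha> \<beta> # \<Psi>) \<theta> \<in> T"
    using Lm_closed[OF Lm_rule.Tensor_Ref1[of LL \<Gamma> \<Phi> \<alpha> \<beta> \<Psi> \<theta>]] wf_T[OF *] by auto
qed

lemma sequent_unit:
  "Sequent \<Gamma> (\<Phi> @ unit_fm LL # \<Psi>) \<theta> \<in> T \<longleftrightarrow> Sequent \<Gamma> (\<Phi> @ \<Psi>) \<theta> \<in> T"
proof
  assume *: "Sequent \<Gamma> (\<Phi> @ unit_fm LL # \<Psi>) \<theta> \<in> T"
  then show "Sequent \<Gamma> (\<Phi> @ \<Psi>) \<theta> \<in> T"
    using Lm_closed[OF Lm_rule.Unit_Ref1[of LL \<Gamma> \<Phi> \<Psi> \<theta>]] wf_T[OF *] by auto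
next
  assume *: "Sequent \<Gamma> (\<Phi> @ \<Psi>) \<theta> \<in> T"
  then show "Sequent \<Gamma> (\<Phi> @ unit_fm LL # \<Psi>) \<theta> \<in> T"
    using Lm_closed[OF Lm_rule.Unit_Ref2[of LL \<Gamma> \<Phi> \<Psi> \<theta>]] wf_T[OF *] by auto
qed

text \<open>Two formulas with the same consequences are interderivable: take each of them as the
  consequence and apply the axiom rule. The two-way rules show that the consequences agree. The
  right unit and associativity follow in the same way.\<close>

lemma tensor_unit_left:
  assumes "is_ctx Sg \<Gamma>" "wf_fm LL Sg \<Gamma> \<phi>"
  shows "(tensor LL (unit_fm LL) \<phi>, \<phi>) \<in> fm_eq T \<Gamma>"
proof -
  have "Sequent \<Gamma> [tensor LL (unit_fm LL) \<phi>] \<theta> \<in> T \<longleftrightarrow> Sequent \<Gamma> [\<phi>] \<theta> \<in> T" for \<theta>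
    using sequent_tensor[of \<Gamma> "[]"] sequent_unit[of \<Gamma> "[]"] by simp
  then show ?thesis
    using assms sequent_refl[of \<Gamma> "tensor LL (unit_fm LL) \<phi>"] sequent_refl[of \<Gamma> \<phi>]
    by (auto simp: fm_eq_def)
qed

lemma tensor_unit_right:
  assumes "is_ctx Sg \<Gamma>" "wf_fm LL Sg \<Gamma> \<phi>"
  shows "(tensor LL \<phi> (unit_fm LL), \<phi>) \<in> fm_eq T \<Gamma>"
proof -
  have "Sequent \<Gamma> [tensor LL \<phi> (unit_fm LL)] \<theta> \<in> T \<longleftrightarrow> Sequent \<Gamma> [\<phi>] \<theta> \<in> T" for \<theta>
    using sequent_tensor[of \<Gamma> "[]"] sequent_unit[of \<Gamma> "[\<phi>]"] by simp
  then show ?thesis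
    using assms sequent_refl[of \<Gamma> "tensor LL \<phi> (unit_fm LL)"] sequent_refl[of \<Gamma> \<phi>]
    by (auto simp: fm_eq_def)
qed

lemma tensor_assoc:
  assumes "is_ctx Sg \<Gamma>" "wf_fm LL Sg \<Gamma> \<phi>" "wf_fm LL Sg \<Gamma> \<psi>" "wf_fm LL Sg \<Gamma> \<theta>"
  shows "(tensor LL (tensor LL \<phi> \<psi>) \<theta>, tensor LL \<phi> (tensor LL \<psi> \<theta>)) \<in> fm_eq T \<Gamma>"
proof -
  have "Sequent \<Gamma> [tensor LL (tensor LL \<phi> \<psi>) \<theta>] \<chi> \<in> T \<longleftrightarrow> Sequent \<Gamma> [tensor LL \<phi> (tensor LL \<psi> \<theta>)] \<chi> \<in> T" for \<chi>
    using sequent_tensor[of \<Gamma> "[]"] sequent_tensor[of \<Gamma> "[\<phi>]" \<psi> \<theta> "[]"] by simp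
  then show ?thesis
    using assms by (auto simp: fm_eq_def intro!: sequent_refl)
qed

lemma fm_eq_tensor:
  "\<lbrakk>(\<phi>, \<phi>') \<in> fm_eq T \<Gamma>; (\<psi>, \<psi>') \<in> fm_eq T \<Gamma>\<rbrakk> \<Longrightarrow> (tensor LL \<phi> \<psi>, tensor LL \<phi>' \<psi>') \<in> fm_eq T \<Gamma>"
  using wf_lang fm_eq_wf(3) by (intro fm_eq_Conn) (auto simp: wf_lang_def)

lemma wf_tensor_list: "\<forall>\<phi> \<in> set \<phi>s. wf_fm LL Sg \<Gamma> \<phi> \<Longrightarrow> wf_fm LL Sg \<Gamma> (tensor_list LL \<phi>s)"
  by (induction \<phi>s rule: induct_list012) auto

text \<open>The singleton clause of \<open>tensor_list\<close> omits the trailing unit, so unfolding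
  at a head holds only up to the right unit law.\<close>

lemma tensor_list_Cons:
  assumes "is_ctx Sg \<Gamma>" "\<forall>\<psi> \<in> set (\<phi> # \<phi>s). wf_fm LL Sg \<Gamma> \<psi>"
  shows "(tensor_list LL (\<phi> # \<phi>s), tensor LL \<phi> (tensor_list LL \<phi>s)) \<in> fm_eq T \<Gamma>"
proof (cases \<phi>s)
  case Nil
  then show ?thesis using assms tensor_unit_right[of \<Gamma> \<phi>] by (auto intro: fm_eq_sym)
next
  case (Cons \<psi> \<psi>s)
  then show ?thesis using assms wf_tensor_list[of \<phi>s \<Gamma>] by (auto intro!: fm_eq_refl)
qed

text \<open>Serves the equality predicate of a product. Either factor may be the empty context,
  which is where the unit laws enter besides associativity.\<close>

lemma tensor_list_append:
  assumes "is_ctx Sg \<Gamma>" "\<forall>\<phi> \<in> set \<phi>s \<union> set \<psi>s. wf_fm LL Sg \<Gamma> \<phi>"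
  shows "(tensor_list LL (\<phi>s @ \<psi>s), tensor LL (tensor_list LL \<phi>s) (tensor_list LL \<psi>s)) \<in> fm_eq T \<Gamma>"
  using assms(2)
proof (induction \<phi>s)
  case Nil
  then show ?case
    using assms(1) tensor_unit_left[of \<Gamma> "tensor_list LL \<psi>s"] by (auto simp: wf_tensor_list intro: fm_eq_sym)
next
  case (Cons \<phi> \<phi>s)
  let ?x = "tensor_list LL \<phi>s" and ?y = "tensor_list LL \<psi>s"
  have wf: "wf_fm LL Sg \<Gamma> \<phi>" "wf_fm LL Sg \<Gamma> ?x" "wf_fm LL Sg \<Gamma> ?y"
    using Cons.prems by (auto intro: wf_tensor_list)
  have "(tensor_list LL (\<phi> # \<phi>s @ \<psi>s), tensor LL \<phi> (tensor_list LL (\<phi>s @ \<psi>s))) \<in> fm_eq T \<Gamma>"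
    using Cons.prems by (intro tensor_list_Cons assms(1)) auto
  also have "(tensor LL \<phi> (tensor_list LL (\<phi>s @ \<psi>s)), tensor LL \<phi> (tensor LL ?x ?y)) \<in> fm_eq T \<Gamma>"
    using Cons wf(1) by (intro fm_eq_tensor fm_eq_refl assms(1)) auto
  also have "(tensor LL \<phi> (tensor LL ?x ?y), tensor LL (tensor LL \<phi> ?x) ?y) \<in> fm_eq T \<Gamma>"
    using wf by (intro fm_eq_sym[OF tensor_assoc] assms(1))
  also have "(tensor LL (tensor LL \<phi> ?x) ?y, tensor LL (tensor_list LL (\<phi> # \<phi>s)) ?y) \<in> fm_eq T \<Gamma>"
    using Cons.prems wf(3)
    by (intro fm_eq_tensor fm_eq_refl fm_eq_sym[OF tensor_list_Cons] assms(1)) auto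
  finally show ?case by simp
qed



subsection \<open>Computing with representatives\<close>

lemma rep_term_class:
  "\<lbrakk>is_ctx Sg \<Gamma>; has_sort Sg \<Gamma> M \<sigma>\<rbrakk> \<Longrightarrow> (M, rep (term_eq T \<Gamma> \<sigma> `` {M})) \<in> term_eq T \<Gamma> \<sigma>"
  using equiv_class_self[OF equiv_term_eq, of \<Gamma> M \<sigma>] someI[of "\<lambda>x. x \<in> term_eq T \<Gamma> \<sigma> `` {M}" M]
  by (simp add: rep_def terms_def)

lemma rep_fm_class:
  "\<lbrakk>is_ctx Sg \<Gamma>; wf_fm LL Sg \<Gamma> \<phi>\<rbrakk> \<Longrightarrow> (\<phi>, rep (fm_class T \<Gamma> \<phi>)) \<in> fm_eq T \<Gamma>"
  using equiv_class_self[OF equiv_fm_eq, of \<Gamma> \<phi>] someI[of "\<lambda>x. x \<in> fm_eq T \<Gamma> `` {\<phi>}" \<phi>]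
  by (simp add: rep_def fms_def fm_class_def)

lemma fm_class_eqI: "(\<phi>, \<psi>) \<in> fm_eq T \<Gamma> \<Longrightarrow> fm_class T \<Gamma> \<phi> = fm_class T \<Gamma> \<psi>"
  unfolding fm_class_def by (rule equiv_class_eq[OF equiv_fm_eq[OF fm_eq_wf(3)]])

lemma mor_class_eqI:
  assumes "mor_eq T \<Gamma> \<Delta> Ms Ms'" "is_ctx Sg \<Gamma>"
  shows "mor_class T \<Gamma> \<Delta> Ms = mor_class T \<Gamma> \<Delta> Ms'"
proof (rule nth_equalityI)
  fix i assume "i < length (mor_class T \<Gamma> \<Delta> Ms)"
  with assms(1) show "mor_class T \<Gamma> \<Delta> Ms ! i = mor_class T \<Gamma> \<Delta> Ms' ! i"
    using equiv_class_eq[OF equiv_term_eq[OF assms(2)]] by (simp add: mor_class_def mor_eq_def)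
qed (use assms(1) in \<open>simp add: mor_class_def mor_eq_def\<close>)

lemma mor_eq_rep:
  assumes "list_all2 (has_sort Sg \<Gamma>) Ms \<Delta>" "is_ctx Sg \<Gamma>"
  shows "mor_eq T \<Gamma> \<Delta> Ms (map rep (mor_class T \<Gamma> \<Delta> Ms))"
  using assms rep_term_class by (auto simp: mor_class_def mor_eq_def list_all2_conv_all_nth)

lemma mor_class_append:
  "length Ns = length \<Theta> \<Longrightarrow>
    mor_class T \<Gamma> (\<Theta> @ \<Delta>) (Ns @ Ms) = mor_class T \<Gamma> \<Theta> Ns @ mor_class T \<Gamma> \<Delta> Ms"
  by (simp add: mor_class_def)

abbreviation CT :: "('s ctx, 'f trm set list, ('q, 'c, 's, 'f, 'r) fm set, 'q, 'c) fa_cat" where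
  "CT \<equiv> classifying LL Sg T"

lemma Obj_CT [simp]: "\<Gamma> \<in> Obj CT \<longleftrightarrow> is_ctx Sg \<Gamma>"
  by (simp add: classifying_def)

lemma Prd_CT [simp]: "Prd CT \<Gamma> \<Delta> = \<Delta> @ \<Gamma>"
  by (simp add: classifying_def)

lemma One_CT [simp]: "One CT = []"
  by (simp add: classifying_def)

lemma is_ctx_append [simp]: "is_ctx Sg (\<Gamma> @ \<Delta>) \<longleftrightarrow> is_ctx Sg \<Gamma> \<and> is_ctx Sg \<Delta>"
  by (auto simp: is_ctx_def)

lemma is_ctx_Nil [simp]: "is_ctx Sg []"
  by (simp add: is_ctx_def)

lemma mor_class_hom:
  "list_all2 (has_sort Sg \<Gamma>) Ms \<Delta> \<Longrightarrow> mor_class T \<Gamma> \<Delta> Ms \<in> Hom CT \<Gamma> \<Delta>"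
  by (auto simp: classifying_def mor_class_def list_all2_conv_all_nth terms_def intro!: quotientI)

lemma hom_cases:
  assumes "X \<in> Hom CT \<Gamma> \<Delta>" "is_ctx Sg \<Gamma>"
  obtains Ms where "list_all2 (has_sort Sg \<Gamma>) Ms \<Delta>" "X = mor_class T \<Gamma> \<Delta> Ms"
proof -
  have "\<exists>M. has_sort Sg \<Gamma> M (\<Delta> ! i) \<and> X ! i = term_eq T \<Gamma> (\<Delta> ! i) `` {M}" if "i < length \<Delta>" for i
    using assms(1) that by (auto simp: classifying_def list_all2_conv_all_nth quotient_def terms_def)
  then obtain f where f: "\<And>i. i < length \<Delta> \<Longrightarrow> has_sort Sg \<Gamma> (f i) (\<Delta> ! i)"
    "\<And>i. i < length \<Delta> \<Longrightarrow> X ! i = term_eq T \<Gamma> (\<Delta> ! i) `` {f i}" by metis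
  have "length X = length \<Delta>"
    using assms(1) by (auto simp: classifying_def list_all2_conv_all_nth)
  with f show thesis
    by (intro that[of "map f [0..<length \<Delta>]"])
      (auto simp: list_all2_conv_all_nth mor_class_def intro!: nth_equalityI)
qed

text \<open>The chosen representatives are provably equal to \<open>Ms\<close> and
  \<open>Ns\<close>, and composition respects this. With the analogous rules for the order,
  reindexing, connectives and quantifiers, later calculations run on terms and formulas instead of
  classes.\<close>

lemma Cmp_mor_class:
  assumes "is_ctx Sg \<Gamma>" "is_ctx Sg \<Delta>" "list_all2 (has_sort Sg \<Gamma>) Ms \<Delta>" "list_all2 (has_sort Sg \<Delta>) Ns \<Theta>"
  shows "Cmp CT \<Gamma> \<Delta> \<Theta> (mor_class T \<Delta> \<Theta> Ns) (mor_class T \<Gamma> \<Delta> Ms) =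
    mor_class T \<Gamma> \<Theta> (map (subst (inst Ms)) Ns)"
  using mor_class_eqI[OF mor_eq_comp[OF assms(1) mor_eq_rep[OF assms(3,1)] mor_eq_rep[OF assms(4,2)]] assms(1)]
  by (simp add: classifying_def)

lemma fm_class_pred: "wf_fm LL Sg \<Gamma> \<phi> \<Longrightarrow> fm_class T \<Gamma> \<phi> \<in> Pred CT \<Gamma>"
  by (auto simp: classifying_def fm_class_def fms_def intro: quotientI)

lemma pred_cases:
  assumes "A \<in> Pred CT \<Gamma>"
  obtains \<phi> where "wf_fm LL Sg \<Gamma> \<phi>" "A = fm_class T \<Gamma> \<phi>"
  using assms by (auto simp: classifying_def fm_class_def fms_def elim: quotientE)

lemma preds_cases:
  assumes "set As \<subseteq> Pred CT \<Gamma>"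
  obtains \<phi>s where "\<forall>\<phi> \<in> set \<phi>s. wf_fm LL Sg \<Gamma> \<phi>" "As = map (fm_class T \<Gamma>) \<phi>s"
proof -
  from assms have "\<exists>\<phi>s. (\<forall>\<phi> \<in> set \<phi>s. wf_fm LL Sg \<Gamma> \<phi>) \<and> As = map (fm_class T \<Gamma>) \<phi>s"
  proof (induction As)
    case (Cons A As)
    then obtain \<phi> \<phi>s where "wf_fm LL Sg \<Gamma> \<phi>" "A = fm_class T \<Gamma> \<phi>"
      "\<forall>\<phi> \<in> set \<phi>s. wf_fm LL Sg \<Gamma> \<phi>" "As = map (fm_class T \<Gamma>) \<phi>s"
      by (auto elim: pred_cases)
    then show ?case by (intro exI[of _ "\<phi> # \<phi>s"]) simp
  qed simp
  with that show thesis by blast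
qed

lemma Leq_fm_class:
  assumes "is_ctx Sg \<Gamma>" "wf_fm LL Sg \<Gamma> \<phi>" "wf_fm LL Sg \<Gamma> \<psi>"
  shows "(fm_class T \<Gamma> \<phi>, fm_class T \<Gamma> \<psi>) \<in> Leq CT \<Gamma> \<longleftrightarrow> Sequent \<Gamma> [\<phi>] \<psi> \<in> T"
proof -
  have "Sequent \<Gamma> [rep (fm_class T \<Gamma> \<phi>)] (rep (fm_class T \<Gamma> \<psi>)) \<in> T \<longleftrightarrow> Sequent \<Gamma> [\<phi>] \<psi> \<in> T"
    using rep_fm_class[OF assms(1,2)] rep_fm_class[OF assms(1,3)]
    by (auto simp: fm_eq_def intro: sequent_trans)
  then show ?thesis
    using fm_class_pred[OF assms(2)] fm_class_pred[OF assms(3)] by (simp add: classifying_def)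
qed

lemma Leq_cases:
  assumes "(A, B) \<in> Leq CT \<Gamma>"
  obtains \<phi> \<psi> where "wf_fm LL Sg \<Gamma> \<phi>" "wf_fm LL Sg \<Gamma> \<psi>"
    "A = fm_class T \<Gamma> \<phi>" "B = fm_class T \<Gamma> \<psi>"
proof -
  have "A \<in> Pred CT \<Gamma>" "B \<in> Pred CT \<Gamma>"
    using assms by (auto simp: classifying_def)
  then show thesis by (meson that pred_cases)
qed

lemma Reindex_fm_class:
  assumes "is_ctx Sg \<Gamma>" "is_ctx Sg \<Delta>" "list_all2 (has_sort Sg \<Gamma>) Ms \<Delta>" "wf_fm LL Sg \<Delta> \<phi>"
  shows "Reindex CT \<Gamma> \<Delta> (mor_class T \<Gamma> \<Delta> Ms) (fm_class T \<Delta> \<phi>) = fm_class T \<Gamma> (fsubst (inst Ms) \<phi>)"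
  using fm_class_eqI[OF fm_eq_inst[OF assms(1) mor_eq_rep[OF assms(3,1)] rep_fm_class[OF assms(2,4)]]]
  by (simp add: classifying_def)

lemma ConnOp_fm_class:
  assumes "is_ctx Sg \<Gamma>" "conns LL k = Some (length \<phi>s)" "\<forall>\<phi> \<in> set \<phi>s. wf_fm LL Sg \<Gamma> \<phi>"
  shows "ConnOp CT k \<Gamma> (map (fm_class T \<Gamma>) \<phi>s) = fm_class T \<Gamma> (Conn k \<phi>s)"
proof -
  have "list_all2 (\<lambda>\<phi> \<phi>'. (\<phi>, \<phi>') \<in> fm_eq T \<Gamma>) \<phi>s (map (rep \<circ> fm_class T \<Gamma>) \<phi>s)"
    using assms rep_fm_class by (simp add: list_all2_conv_all_nth)
  from fm_class_eqI[OF fm_eq_Conn[OF assms(1,2) this]] show ?thesis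
    by (simp add: classifying_def)
qed

lemma QntOp_fm_class:
  assumes "is_ctx Sg \<Gamma>" "is_ctx Sg \<Delta>" "Q \<in> quants LL" "wf_fm LL Sg (\<Delta> @ \<Gamma>) \<phi>"
  shows "QntOp CT Q \<Gamma> \<Delta> (fm_class T (\<Delta> @ \<Gamma>) \<phi>) = fm_class T \<Gamma> (qnt_iter Q \<Delta> \<phi>)"
  using fm_class_eqI[OF fm_eq_qnt_iter[OF rep_fm_class assms(3)]] assms
  by (simp add: classifying_def)

lemma tensor_fm_class:
  assumes "is_ctx Sg \<Gamma>" "wf_fm LL Sg \<Gamma> \<phi>" "wf_fm LL Sg \<Gamma> \<psi>"
  shows "ConnOp CT (tensor_conn LL) \<Gamma> [fm_class T \<Gamma> \<phi>, fm_class T \<Gamma> \<psi>] = fm_class T \<Gamma> (tensor LL \<phi> \<psi>)"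
  using ConnOp_fm_class[of \<Gamma> "tensor_conn LL" "[\<phi>, \<psi>]"] wf_lang assms by (simp add: wf_lang_def)

lemma unit_fm_class:
  assumes "is_ctx Sg \<Gamma>"
  shows "ConnOp CT (unit_conn LL) \<Gamma> [] = fm_class T \<Gamma> (unit_fm LL)"
  using ConnOp_fm_class[of \<Gamma> "unit_conn LL" "[]"] wf_lang assms by (simp add: wf_lang_def)


subsection \<open>The category of contexts\<close>

lemma sorted_comp:
  "\<lbrakk>list_all2 (has_sort Sg \<Gamma>) Ms \<Delta>; list_all2 (has_sort Sg \<Delta>) Ns \<Theta>\<rbrakk> \<Longrightarrow>
    list_all2 (has_sort Sg \<Gamma>) (map (subst (inst Ms)) Ns) \<Theta>"
  by (auto simp: list_all2_conv_all_nth[of _ Ns] list_all2_conv_all_nth[of _ "map f Ns" for f]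
      intro!: has_sort_subst[of Sg \<Delta>] has_sort_inst)

text \<open>Past the end of the list the left side leaves \<open>Var i\<close> while the right side
  applies \<open>s\<close> to it, so the equation is confined to terms over \<Delta>.\<close>

lemma subst_inst_comp:
  assumes "has_sort Sg \<Delta> N \<tau>" "length Ms = length \<Delta>"
  shows "subst (inst (map s Ms)) N = subst (\<lambda>i. s (inst Ms i)) N"
  using assms by (auto simp: inst_def intro: subst_cong)

lemma inst_Vars [simp]: "inst (map Var [0..<n]) = Var"
  by (auto simp: inst_def fun_eq_iff)

text \<open>The middle block of a threefold product. The identity and both projections are the cases
  in which outer blocks are empty.\<close>

lemma sorted_Vars:
  "list_all2 (has_sort Sg (\<Theta> @ \<Delta> @ \<Gamma>)) (map Var [length \<Theta>..<length \<Theta> + length \<Delta>]) \<Delta>"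
  using has_sort_append[OF has_sort_shift, of _ \<Delta> Sg \<Theta> \<Gamma>] by (auto simp: list_all2_conv_all_nth)

lemma inst_append_Vars_fst:
  "length Ms = n \<Longrightarrow> length Ns = k \<Longrightarrow> map (inst (Ns @ Ms)) [k..<k + n] = Ms"
  by (auto simp: inst_def nth_append intro!: nth_equalityI)

lemma inst_append_Vars_snd:
  "length Ns = k \<Longrightarrow> map (inst (Ns @ Ms)) [0..<k] = Ns"
  by (auto simp: inst_def nth_append intro!: nth_equalityI)

lemma Ide_CT: "Ide CT \<Gamma> = mor_class T \<Gamma> \<Gamma> (map Var [0..<length \<Gamma>])"
  by (simp add: classifying_def)

lemma Fst_CT: "Fst CT \<Gamma> \<Delta> = mor_class T (\<Delta> @ \<Gamma>) \<Gamma> (map Var [length \<Delta>..<length \<Delta> + length \<Gamma>])"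
  by (simp add: classifying_def)

lemma Snd_CT: "Snd CT \<Gamma> \<Delta> = mor_class T (\<Delta> @ \<Gamma>) \<Delta> (map Var [0..<length \<Delta>])"
  by (simp add: classifying_def)

lemma sorted_Ide: "list_all2 (has_sort Sg \<Gamma>) (map Var [0..<length \<Gamma>]) \<Gamma>"
  using sorted_Vars[of "[]" \<Gamma> "[]"] by simp

lemma sorted_Fst: "list_all2 (has_sort Sg (\<Delta> @ \<Gamma>)) (map Var [length \<Delta>..<length \<Delta> + length \<Gamma>]) \<Gamma>"
  using sorted_Vars[of \<Delta> \<Gamma> "[]"] by simp

lemma sorted_Snd: "list_all2 (has_sort Sg (\<Delta> @ \<Gamma>)) (map Var [0..<length \<Delta>]) \<Delta>"
  using sorted_Vars[of "[]" \<Delta> \<Gamma>] by simp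

text \<open>The second factor of a product is declared last and stands at the head, so the pair of
  \<open>Ms\<close> and \<open>Ns\<close> is the list \<open>Ns @ Ms\<close>.\<close>

lemma Fst_Cmp:
  assumes "is_ctx Sg \<Theta>" "is_ctx Sg \<Gamma>" "is_ctx Sg \<Delta>"
    "list_all2 (has_sort Sg \<Theta>) Ms \<Gamma>" "list_all2 (has_sort Sg \<Theta>) Ns \<Delta>"
  shows "Cmp CT \<Theta> (\<Delta> @ \<Gamma>) \<Gamma> (Fst CT \<Gamma> \<Delta>) (mor_class T \<Theta> (\<Delta> @ \<Gamma>) (Ns @ Ms)) = mor_class T \<Theta> \<Gamma> Ms"
proof -
  have "map (inst (Ns @ Ms)) [length \<Delta>..<length \<Delta> + length \<Gamma>] = Ms"
    using assms(4,5) by (intro inst_append_Vars_fst) (auto dest: list_all2_lengthD)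
  then show ?thesis
    using assms sorted_Fst[of \<Delta> \<Gamma>]
    by (simp add: Fst_CT Cmp_mor_class list_all2_appendI comp_def)
qed

lemma Snd_Cmp:
  assumes "is_ctx Sg \<Theta>" "is_ctx Sg \<Gamma>" "is_ctx Sg \<Delta>"
    "list_all2 (has_sort Sg \<Theta>) Ms \<Gamma>" "list_all2 (has_sort Sg \<Theta>) Ns \<Delta>"
  shows "Cmp CT \<Theta> (\<Delta> @ \<Gamma>) \<Delta> (Snd CT \<Gamma> \<Delta>) (mor_class T \<Theta> (\<Delta> @ \<Gamma>) (Ns @ Ms)) = mor_class T \<Theta> \<Delta> Ns"
proof -
  have "map (inst (Ns @ Ms)) [0..<length \<Delta>] = Ns"
    using assms(4,5) by (intro inst_append_Vars_snd) (auto dest: list_all2_lengthD)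
  then show ?thesis
    using assms sorted_Snd[of \<Delta> \<Gamma>]
    by (simp add: Snd_CT Cmp_mor_class list_all2_appendI comp_def)
qed

lemma hom_prd_cases:
  assumes "h \<in> Hom CT \<Theta> (\<Delta> @ \<Gamma>)" "is_ctx Sg \<Theta>"
  obtains Ms Ns where "list_all2 (has_sort Sg \<Theta>) Ms \<Gamma>" "list_all2 (has_sort Sg \<Theta>) Ns \<Delta>"
    "h = mor_class T \<Theta> (\<Delta> @ \<Gamma>) (Ns @ Ms)"
  using assms by (metis hom_cases list_all2_append2)

text \<open>As an equivalence this gives both the unique existence in the universal property and the
  value of the description in \<open>pairing\<close>. Uniqueness holds because classes are formed
  entrywise: a morphism into a product is the concatenation of its two projections.\<close>

lemma pairing_unique:
  assumes "is_ctx Sg \<Theta>" "is_ctx Sg \<Gamma>" "is_ctx Sg \<Delta>"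
    "list_all2 (has_sort Sg \<Theta>) Ms \<Gamma>" "list_all2 (has_sort Sg \<Theta>) Ns \<Delta>"
  shows "h \<in> Hom CT \<Theta> (\<Delta> @ \<Gamma>) \<and>
      Cmp CT \<Theta> (\<Delta> @ \<Gamma>) \<Gamma> (Fst CT \<Gamma> \<Delta>) h = mor_class T \<Theta> \<Gamma> Ms \<and>
      Cmp CT \<Theta> (\<Delta> @ \<Gamma>) \<Delta> (Snd CT \<Gamma> \<Delta>) h = mor_class T \<Theta> \<Delta> Ns \<longleftrightarrow>
    h = mor_class T \<Theta> (\<Delta> @ \<Gamma>) (Ns @ Ms)" (is "?L \<longleftrightarrow> ?R")
proof
  assume L: ?L
  with assms(1) obtain Ms' Ns' where *: "list_all2 (has_sort Sg \<Theta>) Ms' \<Gamma>"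
    "list_all2 (has_sort Sg \<Theta>) Ns' \<Delta>" "h = mor_class T \<Theta> (\<Delta> @ \<Gamma>) (Ns' @ Ms')"
    by (meson hom_prd_cases)
  with L assms have "mor_class T \<Theta> \<Gamma> Ms' = mor_class T \<Theta> \<Gamma> Ms" "mor_class T \<Theta> \<Delta> Ns' = mor_class T \<Theta> \<Delta> Ns"
    by (simp_all add: Fst_Cmp Snd_Cmp)
  with * assms(5) show ?R by (simp add: mor_class_append list_all2_lengthD)
next
  assume ?R
  with assms show ?L by (simp add: Fst_Cmp Snd_Cmp mor_class_hom list_all2_appendI)
qed

lemma pairing_CT:
  assumes "is_ctx Sg \<Theta>" "is_ctx Sg \<Gamma>" "is_ctx Sg \<Delta>"
    "list_all2 (has_sort Sg \<Theta>) Ms \<Gamma>" "list_all2 (has_sort Sg \<Theta>) Ns \<Delta>"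
  shows "pairing CT \<Theta> \<Gamma> \<Delta> (mor_class T \<Theta> \<Gamma> Ms) (mor_class T \<Theta> \<Delta> Ns) =
    mor_class T \<Theta> (\<Delta> @ \<Gamma>) (Ns @ Ms)"
  unfolding pairing_def Prd_CT pairing_unique[OF assms] by simp

lemma fp_category_CT: "fp_category CT"
proof
  fix \<Gamma> assume "\<Gamma> \<in> Obj CT"
  \<comment> \<open>A morphism into \<open>[]\<close> has one entry for each variable of the empty
    context, so it is the empty list.\<close>
  then show "Ide CT \<Gamma> \<in> Hom CT \<Gamma> \<Gamma>" "\<exists>!f. f \<in> Hom CT \<Gamma> (One CT)"
    by (simp_all add: Ide_CT mor_class_hom sorted_Ide) (auto simp: classifying_def)
next
  fix \<Gamma> \<Delta> f assume *: "\<Gamma> \<in> Obj CT" "\<Delta> \<in> Obj CT" "f \<in> Hom CT \<Gamma> \<Delta>"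
  then obtain Ms where Ms: "list_all2 (has_sort Sg \<Gamma>) Ms \<Delta>" "f = mor_class T \<Gamma> \<Delta> Ms"
    by (auto elim: hom_cases)
  have "map (inst Ms) [0..<length \<Delta>] = Ms"
    using inst_append_Vars_snd[of Ms "length \<Delta>" "[]"] Ms(1) by (simp add: list_all2_lengthD)
  with * Ms show "Cmp CT \<Gamma> \<Delta> \<Delta> (Ide CT \<Delta>) f = f" "Cmp CT \<Gamma> \<Gamma> \<Delta> f (Ide CT \<Gamma>) = f"
    by (simp_all add: Ide_CT Cmp_mor_class sorted_Ide comp_def map_idI)
next
  fix \<Gamma> \<Delta> \<Theta> f g
  assume "\<Gamma> \<in> Obj CT" "\<Delta> \<in> Obj CT" "\<Theta> \<in> Obj CT" "f \<in> Hom CT \<Gamma> \<Delta>" "g \<in> Hom CT \<Delta> \<Theta>"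
  then show "Cmp CT \<Gamma> \<Delta> \<Theta> g f \<in> Hom CT \<Gamma> \<Theta>"
    by (auto simp: Cmp_mor_class sorted_comp intro!: mor_class_hom elim!: hom_cases)
next
  fix \<Gamma> \<Delta> \<Theta> \<Xi> f g h
  assume *: "\<Gamma> \<in> Obj CT" "\<Delta> \<in> Obj CT" "\<Theta> \<in> Obj CT" "\<Xi> \<in> Obj CT"
    "f \<in> Hom CT \<Gamma> \<Delta>" "g \<in> Hom CT \<Delta> \<Theta>" "h \<in> Hom CT \<Theta> \<Xi>"
  then obtain Ms Ns Ps where
    Ms: "list_all2 (has_sort Sg \<Gamma>) Ms \<Delta>" "f = mor_class T \<Gamma> \<Delta> Ms" and
    Ns: "list_all2 (has_sort Sg \<Delta>) Ns \<Theta>" "g = mor_class T \<Delta> \<Theta> Ns" and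
    Ps: "list_all2 (has_sort Sg \<Theta>) Ps \<Xi>" "h = mor_class T \<Theta> \<Xi> Ps"
    by (metis Obj_CT hom_cases)
  have "subst (inst (map (subst (inst Ms)) Ns)) P = subst (inst Ms) (subst (inst Ns) P)"
    if "P \<in> set Ps" for P
    using that Ps(1) Ns(1) subst_inst_comp[of \<Theta> P _ Ns]
    by (auto simp: subst_subst list_all2_conv_all_nth in_set_conv_nth)
  then have "map (subst (inst (map (subst (inst Ms)) Ns))) Ps =
      map (subst (inst Ms)) (map (subst (inst Ns)) Ps)"
    by simp
  with * show "Cmp CT \<Gamma> \<Theta> \<Xi> h (Cmp CT \<Gamma> \<Delta> \<Theta> g f) = Cmp CT \<Gamma> \<Delta> \<Xi> (Cmp CT \<Delta> \<Theta> \<Xi> h g) f"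
    using sorted_comp[OF Ms(1) Ns(1)] sorted_comp[OF Ns(1) Ps(1)] Ms Ns Ps
    by (simp add: Cmp_mor_class del: map_map map_eq_conv)
next
  fix \<Gamma> \<Delta> assume "\<Gamma> \<in> Obj CT" "\<Delta> \<in> Obj CT"
  then show "Prd CT \<Gamma> \<Delta> \<in> Obj CT" "Fst CT \<Gamma> \<Delta> \<in> Hom CT (Prd CT \<Gamma> \<Delta>) \<Gamma>"
    "Snd CT \<Gamma> \<Delta> \<in> Hom CT (Prd CT \<Gamma> \<Delta>) \<Delta>"
    by (simp_all add: Fst_CT Snd_CT mor_class_hom sorted_Fst sorted_Snd)
next
  fix \<Gamma> \<Delta> \<Theta> f g
  assume *: "\<Gamma> \<in> Obj CT" "\<Delta> \<in> Obj CT" "\<Theta> \<in> Obj CT" "f \<in> Hom CT \<Theta> \<Gamma>" "g \<in> Hom CT \<Theta> \<Delta>"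
  then obtain Ms Ns where Ms: "list_all2 (has_sort Sg \<Theta>) Ms \<Gamma>" "f = mor_class T \<Theta> \<Gamma> Ms"
    and Ns: "list_all2 (has_sort Sg \<Theta>) Ns \<Delta>" "g = mor_class T \<Theta> \<Delta> Ns"
    by (metis Obj_CT hom_cases)
  with * show "\<exists>!h. h \<in> Hom CT \<Theta> (Prd CT \<Gamma> \<Delta>) \<and>
      Cmp CT \<Theta> (Prd CT \<Gamma> \<Delta>) \<Gamma> (Fst CT \<Gamma> \<Delta>) h = f \<and>
      Cmp CT \<Theta> (Prd CT \<Gamma> \<Delta>) \<Delta> (Snd CT \<Gamma> \<Delta>) h = g"
    unfolding Ms(2) Ns(2) Prd_CT by (subst pairing_unique) simp_all
qed simp_all



subsection \<open>The predicates\<close>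

lemma fsubst_inst_comp:
  assumes "wf_fm LL Sg \<Delta> \<phi>" "length Ms = length \<Delta>"
  shows "fsubst (inst (map s Ms)) \<phi> = fsubst (\<lambda>i. s (inst Ms i)) \<phi>"
  using assms by (auto simp: inst_def intro: fsubst_cong)

lemma wf_fm_inst:
  "\<lbrakk>wf_fm LL Sg \<Delta> \<phi>; list_all2 (has_sort Sg \<Gamma>) Ms \<Delta>\<rbrakk> \<Longrightarrow> wf_fm LL Sg \<Gamma> (fsubst (inst Ms) \<phi>)"
  by (rule wf_fm_fsubst) (auto intro: has_sort_inst)

lemma partial_order_CT:
  assumes "is_ctx Sg \<Gamma>"
  shows "partial_order_on (Pred CT \<Gamma>) (Leq CT \<Gamma>)"
  unfolding partial_order_on_def preorder_on_def
proof (intro conjI)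
  show "Leq CT \<Gamma> \<subseteq> Pred CT \<Gamma> \<times> Pred CT \<Gamma>"
    by (auto simp: classifying_def)
  show "refl_on (Pred CT \<Gamma>) (Leq CT \<Gamma>)"
    using assms by (auto simp: refl_on_def Leq_fm_class sequent_refl elim!: pred_cases)
  show "trans (Leq CT \<Gamma>)"
  proof (rule transI)
    fix A B D assume *: "(A, B) \<in> Leq CT \<Gamma>" "(B, D) \<in> Leq CT \<Gamma>"
    then have "A \<in> Pred CT \<Gamma>" "B \<in> Pred CT \<Gamma>" "D \<in> Pred CT \<Gamma>"
      by (auto simp: classifying_def)
    with * assms show "(A, D) \<in> Leq CT \<Gamma>"
      by (auto simp: Leq_fm_class elim!: pred_cases intro: sequent_trans)
  qed
  show "antisym (Leq CT \<Gamma>)"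
  proof (rule antisymI)
    fix A B assume *: "(A, B) \<in> Leq CT \<Gamma>" "(B, A) \<in> Leq CT \<Gamma>"
    then have "A \<in> Pred CT \<Gamma>" "B \<in> Pred CT \<Gamma>"
      by (auto simp: classifying_def)
    with * assms show "A = B"
      by (auto simp: Leq_fm_class fm_eq_def elim!: pred_cases intro!: fm_class_eqI)
  qed
qed

lemma prop_category_CT: "prop_category CT"
proof -
  interpret fp_category CT by (rule fp_category_CT)
  show ?thesis
  proof
    fix \<Gamma> assume "\<Gamma> \<in> Obj CT"
    then show "partial_order_on (Pred CT \<Gamma>) (Leq CT \<Gamma>)" by (simp add: partial_order_CT)
  next
    fix \<Gamma> \<Delta> f A assume "\<Gamma> \<in> Obj CT" "\<Delta> \<in> Obj CT" "f \<in> Hom CT \<Gamma> \<Delta>" "A \<in> Pred CT \<Delta>"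
    then show "Reindex CT \<Gamma> \<Delta> f A \<in> Pred CT \<Gamma>"
      by (auto simp: Reindex_fm_class wf_fm_inst intro!: fm_class_pred elim!: pred_cases hom_cases)
  next
    fix \<Gamma> \<Delta> f A B assume *: "\<Gamma> \<in> Obj CT" "\<Delta> \<in> Obj CT" "f \<in> Hom CT \<Gamma> \<Delta>" "(A, B) \<in> Leq CT \<Delta>"
    obtain Ms where Ms: "list_all2 (has_sort Sg \<Gamma>) Ms \<Delta>" "f = mor_class T \<Gamma> \<Delta> Ms"
      using * by (auto elim: hom_cases)
    obtain \<phi> \<psi> where wf: "wf_fm LL Sg \<Delta> \<phi>" "wf_fm LL Sg \<Delta> \<psi>"
      and AB: "A = fm_class T \<Delta> \<phi>" "B = fm_class T \<Delta> \<psi>"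
      using *(4) by (rule Leq_cases)
    show "(Reindex CT \<Gamma> \<Delta> f A, Reindex CT \<Gamma> \<Delta> f B) \<in> Leq CT \<Gamma>"
      using * Ms wf wf_fm_inst[OF wf(1) Ms(1)] wf_fm_inst[OF wf(2) Ms(1)]
      by (simp add: AB Reindex_fm_class Leq_fm_class sequent_inst[OF _ mor_eq_refl])
  next
    fix \<Gamma> A assume "\<Gamma> \<in> Obj CT" "A \<in> Pred CT \<Gamma>"
    then show "Reindex CT \<Gamma> \<Gamma> (Ide CT \<Gamma>) A = A"
      by (auto simp: Ide_CT Reindex_fm_class sorted_Ide elim!: pred_cases)
  next
    fix \<Gamma> \<Delta> \<Theta> f g A
    assume *: "\<Gamma> \<in> Obj CT" "\<Delta> \<in> Obj CT" "\<Theta> \<in> Obj CT" "f \<in> Hom CT \<Gamma> \<Delta>" "g \<in> Hom CT \<Delta> \<Theta>"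
      "A \<in> Pred CT \<Theta>"
    obtain Ms where Ms: "list_all2 (has_sort Sg \<Gamma>) Ms \<Delta>" "f = mor_class T \<Gamma> \<Delta> Ms"
      using * by (auto elim: hom_cases)
    obtain Ns where Ns: "list_all2 (has_sort Sg \<Delta>) Ns \<Theta>" "g = mor_class T \<Delta> \<Theta> Ns"
      using * by (auto elim: hom_cases)
    obtain \<phi> where \<phi>: "wf_fm LL Sg \<Theta> \<phi>" "A = fm_class T \<Theta> \<phi>"
      using *(6) by (rule pred_cases)
    have "fsubst (inst (map (subst (inst Ms)) Ns)) \<phi> = fsubst (inst Ms) (fsubst (inst Ns) \<phi>)"
      using \<phi>(1) Ns(1) by (simp add: fsubst_fsubst fsubst_inst_comp list_all2_lengthD)
    then show "Reindex CT \<Gamma> \<Theta> (Cmp CT \<Gamma> \<Delta> \<Theta> g f) A = Reindex CT \<Gamma> \<Delta> f (Reindex CT \<Delta> \<Theta> g A)"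
      using * Ms Ns \<phi> sorted_comp[OF Ms(1) Ns(1)] wf_fm_inst[OF \<phi>(1) Ns(1)]
      by (simp add: Cmp_mor_class Reindex_fm_class)
  qed
qed

section \<open>Quantifiers, reassociation and the tensor monoid\<close>

lemma times_ide_CT:
  assumes "is_ctx Sg \<Gamma>" "is_ctx Sg \<Delta>" "is_ctx Sg \<Theta>" "list_all2 (has_sort Sg \<Gamma>) Ms \<Delta>"
  defines "Ms' \<equiv> map (subst (inst (map Var [length \<Theta>..<length \<Theta> + length \<Gamma>]))) Ms"
  shows "times_ide CT \<Gamma> \<Delta> \<Theta> (mor_class T \<Gamma> \<Delta> Ms) =
      mor_class T (\<Theta> @ \<Gamma>) (\<Theta> @ \<Delta>) (map Var [0..<length \<Theta>] @ Ms')"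
    and "list_all2 (has_sort Sg (\<Theta> @ \<Gamma>)) (map Var [0..<length \<Theta>] @ Ms') (\<Theta> @ \<Delta>)"
proof -
  \<comment> \<open>\<open>Ms'\<close> is \<open>Ms\<close> shifted past \<Theta>, written as a
    composite with the first projection, so that the sorts come from those of a composite.\<close>
  have Ms': "list_all2 (has_sort Sg (\<Theta> @ \<Gamma>)) Ms' \<Delta>"
    unfolding Ms'_def by (rule sorted_comp[OF sorted_Fst assms(4)])
  then show "list_all2 (has_sort Sg (\<Theta> @ \<Gamma>)) (map Var [0..<length \<Theta>] @ Ms') (\<Theta> @ \<Delta>)"
    by (intro list_all2_appendI sorted_Snd)
  have "Cmp CT (\<Theta> @ \<Gamma>) \<Gamma> \<Delta> (mor_class T \<Gamma> \<Delta> Ms) (Fst CT \<Gamma> \<Theta>) = mor_class T (\<Theta> @ \<Gamma>) \<Delta> Ms'"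
    using assms sorted_Fst by (simp add: Fst_CT Cmp_mor_class)
  then show "times_ide CT \<Gamma> \<Delta> \<Theta> (mor_class T \<Gamma> \<Delta> Ms) =
      mor_class T (\<Theta> @ \<Gamma>) (\<Theta> @ \<Delta>) (map Var [0..<length \<Theta>] @ Ms')"
    using assms(1-4) Ms' sorted_Snd by (simp add: times_ide_def Snd_CT pairing_CT)
qed

text \<open>Moving the substitution \<open>inst Ms\<close> under the \<open>length \<Theta>\<close>
  binders lifts it that many times, and the term list of the product of \<open>f\<close> with the
  identity of \<Theta> is exactly this lifted substitution.\<close>

lemma qnt_natural_CT:
  assumes "Q \<in> quants LL" "is_ctx Sg \<Gamma>" "is_ctx Sg \<Delta>" "is_ctx Sg \<Theta>" "f \<in> Hom CT \<Gamma> \<Delta>"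
    "A \<in> Pred CT (\<Theta> @ \<Delta>)"
  shows "QntOp CT Q \<Gamma> \<Theta> (Reindex CT (\<Theta> @ \<Gamma>) (\<Theta> @ \<Delta>) (times_ide CT \<Gamma> \<Delta> \<Theta> f) A) =
    Reindex CT \<Gamma> \<Delta> f (QntOp CT Q \<Delta> \<Theta> A)"
proof -
  obtain Ms where Ms: "list_all2 (has_sort Sg \<Gamma>) Ms \<Delta>" and f: "f = mor_class T \<Gamma> \<Delta> Ms"
    using assms by (auto elim: hom_cases)
  obtain \<phi> where \<phi>: "wf_fm LL Sg (\<Theta> @ \<Delta>) \<phi>" and A: "A = fm_class T (\<Theta> @ \<Delta>) \<phi>"
    using assms(6) by (rule pred_cases)
  define Ns where "Ns = map (Var :: nat \<Rightarrow> 'f trm) [0..<length \<Theta>] @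
    map (subst (inst (map Var [length \<Theta>..<length \<Theta> + length \<Gamma>]))) Ms"
  have ti: "times_ide CT \<Gamma> \<Delta> \<Theta> (mor_class T \<Gamma> \<Delta> Ms) = mor_class T (\<Theta> @ \<Gamma>) (\<Theta> @ \<Delta>) Ns"
    and Ns: "list_all2 (has_sort Sg (\<Theta> @ \<Gamma>)) Ns (\<Theta> @ \<Delta>)"
    unfolding Ns_def using times_ide_CT[OF assms(2-4) Ms] by auto
  have "fsubst (inst Ns) \<phi> = fsubst ((lift ^^ length \<Theta>) (inst Ms)) \<phi>"
    using \<phi>
  proof (rule fsubst_cong)
    fix i assume i: "i < length (\<Theta> @ \<Delta>)"
    show "inst Ns i = (lift ^^ length \<Theta>) (inst Ms) i"
    proof (cases "i < length \<Theta>")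
      case True
      then show ?thesis by (simp add: funpow_lift Ns_def inst_def nth_append)
    next
      case False
      let ?M = "Ms ! (i - length \<Theta>)"
      have "has_sort Sg \<Gamma> ?M (\<Delta> ! (i - length \<Theta>))"
        using Ms i False by (auto simp: list_all2_conv_all_nth)
      \<comment> \<open>The term list of the projection shifts the indices below
        \<open>length \<Gamma>\<close> and fixes the others; it acts as a plain shift because
        \<open>?M\<close> is sorted over \<Gamma>.\<close>
      then have "subst (inst (map Var [length \<Theta>..<length \<Theta> + length \<Gamma>])) ?M =
          subst (\<lambda>k. Var (length \<Theta> + k)) ?M"
        by (rule subst_cong) (simp add: inst_def)
      moreover have "i - length \<Theta> < length \<Delta>"
        using i False by simp
      ultimately show ?thesis
        using i False list_all2_lengthD[OF Ms] by (simp add: funpow_lift Ns_def inst_def nth_append)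
    qed
  qed
  then show ?thesis
    using assms(1-4) Ms Ns \<phi> wf_fm_inst[OF \<phi> Ns] wf_fm_qnt_iter[OF \<phi>]
    by (simp add: ti A f Reindex_fm_class QntOp_fm_class fsubst_qnt_iter)
qed

lemma reassoc_CT:
  assumes "is_ctx Sg \<Gamma>" "is_ctx Sg \<Delta>" "is_ctx Sg \<Theta>"
  shows "reassoc CT \<Gamma> \<Delta> \<Theta> = Ide CT (\<Theta> @ \<Delta> @ \<Gamma>)"
proof -
  let ?X = "\<Theta> @ \<Delta> @ \<Gamma>" and ?n = "length \<Theta>" and ?m = "length \<Delta>" and ?k = "length \<Gamma>"
  have \<Gamma>: "list_all2 (has_sort Sg ?X) (map Var [?n + ?m..<?n + ?m + ?k]) \<Gamma>"
    using sorted_Vars[of "\<Theta> @ \<Delta>" \<Gamma> "[]"] by simp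
  have \<Delta>: "list_all2 (has_sort Sg ?X) (map Var [?n..<?n + ?m]) \<Delta>"
    by (rule sorted_Vars)
  have \<Theta>: "list_all2 (has_sort Sg ?X) (map Var [0..<?n]) \<Theta>"
    using sorted_Vars[of "[]" \<Theta> "\<Delta> @ \<Gamma>"] by simp
  \<comment> \<open>Cutting the list where \<Delta> begins gives it the form of a pair, from which
    \<open>Fst_Cmp\<close> and \<open>Snd_Cmp\<close> read off the two components.\<close>
  have Snd: "Snd CT \<Gamma> (\<Theta> @ \<Delta>) = mor_class T ?X (\<Theta> @ \<Delta>) (map Var [0..<?n] @ map Var [?n..<?n + ?m])"
    by (simp add: Snd_CT flip: map_append upt_add_eq_append)
  have "reassoc CT \<Gamma> \<Delta> \<Theta> =
    pairing CT ?X (\<Delta> @ \<Gamma>) \<Theta>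
      (pairing CT ?X \<Gamma> \<Delta> (mor_class T ?X \<Gamma> (map Var [?n + ?m..<?n + ?m + ?k]))
        (mor_class T ?X \<Delta> (map Var [?n..<?n + ?m])))
      (mor_class T ?X \<Theta> (map Var [0..<?n]))"
    using assms \<Delta> \<Theta> Fst_Cmp[of ?X \<Delta> \<Theta>] Snd_Cmp[of ?X \<Delta> \<Theta>]
    by (simp add: reassoc_def Let_def Fst_CT[of \<Gamma> "\<Theta> @ \<Delta>"] Snd)
  also have "\<dots> = mor_class T ?X ?X (map Var [0..<?n] @ map Var [?n..<?n + ?m] @
      map Var [?n + ?m..<?n + ?m + ?k])"
    using assms \<Gamma> \<Delta> \<Theta> by (simp add: pairing_CT list_all2_appendI)
  also have "\<dots> = Ide CT ?X"
    using upt_add_eq_append[of 0 ?n "?m + ?k"] upt_add_eq_append[of ?n "?n + ?m" ?k]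
    by (simp add: Ide_CT add.assoc flip: map_append)
  finally show ?thesis .
qed

lemma tensor_monoid_CT:
  assumes "is_ctx Sg \<Gamma>"
  shows "monoid \<lparr>carrier = Pred CT \<Gamma>, mult = (\<lambda>p q. ConnOp CT (tensor_conn LL) \<Gamma> [p, q]),
    one = ConnOp CT (unit_conn LL) \<Gamma> []\<rparr>"
  using assms
  by unfold_locales
    (auto simp: tensor_fm_class unit_fm_class wf_tensor fm_class_eqI[OF tensor_assoc]
      fm_class_eqI[OF tensor_unit_left] fm_class_eqI[OF tensor_unit_right]
      elim!: pred_cases intro!: fm_class_pred)

section \<open>Equality predicates\<close>

lemma wf_eq_fm:
  assumes "is_ctx Sg \<Gamma>"
  shows "wf_fm LL Sg (\<Gamma> @ \<Gamma>) (eq_fm LL \<Gamma>)"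
proof -
  have "wf_fm LL Sg (\<Gamma> @ \<Gamma>) (Eql (\<Gamma> ! i) (Var (length \<Gamma> + i)) (Var i))" if "i < length \<Gamma>" for i
    using assms that has_sort_shift[of i \<Gamma> Sg \<Gamma>] has_sort.Var[of i "\<Gamma> @ \<Gamma>" Sg]
    by (intro wf_fm.Eql) (auto simp: is_ctx_def nth_append)
  then show ?thesis unfolding eq_fm_def by (intro wf_tensor_list) auto
qed

lemma EqP_CT: "EqP CT \<Gamma> = fm_class T (\<Gamma> @ \<Gamma>) (eq_fm LL \<Gamma>)"
  by (simp add: classifying_def)

text \<open>If \<open>\<Gamma>\<close> is the segment of \<open>\<Delta>\<close> that starts at position \<open>n\<close>, reindexing the equality of \<open>\<Gamma>\<close> along
  the square of the projection \<open>\<Delta> \<rightarrow> \<Gamma>\<close> gives the corresponding part of the equality of \<open>\<Delta>\<close>.\<close>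

lemma Reindex_square_EqP:
  fixes n :: nat and \<Gamma> \<Delta> :: "'s ctx"
  defines "Ms \<equiv> map Var [n..<n + length \<Gamma>]"
  assumes "is_ctx Sg \<Gamma>" "is_ctx Sg \<Delta>" "list_all2 (has_sort Sg \<Delta>) Ms \<Gamma>"
  shows "Reindex CT (\<Delta> @ \<Delta>) (\<Gamma> @ \<Gamma>) (square CT \<Delta> \<Gamma> (mor_class T \<Delta> \<Gamma> Ms)) (EqP CT \<Gamma>) =
    fm_class T (\<Delta> @ \<Delta>) (tensor_list LL
      (rev (map (\<lambda>i. Eql (\<Delta> ! i) (Var (length \<Delta> + i)) (Var i)) [n..<n + length \<Gamma>])))"
proof -
  \<comment> \<open>In \<open>\<Delta> @ \<Delta>\<close> the first copy of \<Delta> lies behind the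
    second, so the first component is \<open>Ms\<close> shifted by \<open>length \<Delta>\<close>,
    while the second component is \<open>Ms\<close> unchanged.\<close>
  let ?F = "map (subst (inst (map Var [length \<Delta>..<length \<Delta> + length \<Delta>]))) Ms"
  have sorted: "list_all2 (has_sort Sg (\<Delta> @ \<Delta>)) ?F \<Gamma>" "list_all2 (has_sort Sg (\<Delta> @ \<Delta>)) Ms \<Gamma>"
    using sorted_comp[OF sorted_Fst[of \<Delta> \<Delta>] assms(4)] sorted_comp[OF sorted_Snd[of \<Delta> \<Delta>] assms(4)]
    by (simp_all add: map_idI)
  have "square CT \<Delta> \<Gamma> (mor_class T \<Delta> \<Gamma> Ms) = mor_class T (\<Delta> @ \<Delta>) (\<Gamma> @ \<Gamma>) (Ms @ ?F)"
    using assms(2-4) sorted sorted_Fst[of \<Delta> \<Delta>] sorted_Snd[of \<Delta> \<Delta>]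
    by (simp add: square_def Fst_CT Snd_CT Cmp_mor_class pairing_CT map_idI)
  \<comment> \<open>Inverting the typing of the variables in \<open>Ms\<close> shows that \<Gamma>
    is the segment of \<Delta> starting at position \<open>n\<close>.\<close>
  moreover have segment: "n + i < length \<Delta>" "\<Delta> ! (n + i) = \<Gamma> ! i" if "i < length \<Gamma>" for i
  proof -
    have "has_sort Sg \<Delta> (Var (n + i)) (\<Gamma> ! i)"
      using assms(4) that by (auto simp: list_all2_conv_all_nth Ms_def)
    then show "n + i < length \<Delta>" "\<Delta> ! (n + i) = \<Gamma> ! i" by (cases; simp)+
  qed
  have "fsubst (inst (Ms @ ?F)) (eq_fm LL \<Gamma> :: ('q, 'c, 's, 'f, 'r) fm) = tensor_list LL
      (rev (map (\<lambda>i. Eql (\<Delta> ! i) (Var (length \<Delta> + i)) (Var i)) [n..<n + length \<Gamma>]))"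
  proof -
    have "map (fsubst (inst (Ms @ ?F)))
        (map (\<lambda>i. Eql (\<Gamma> ! i) (Var (length \<Gamma> + i)) (Var i)) [0..<length \<Gamma>]) =
      map (\<lambda>i. Eql (\<Delta> ! i) (Var (length \<Delta> + i)) (Var i)) [n..<n + length \<Gamma>]"
      by (rule nth_equalityI) (simp_all add: segment inst_def nth_append Ms_def)
    then show ?thesis unfolding eq_fm_def fsubst_tensor_list rev_map[symmetric] by (rule arg_cong)
  qed
  ultimately show ?thesis
    using assms(2,3) sorted wf_eq_fm[OF assms(2)]
    by (simp add: EqP_CT Reindex_fm_class list_all2_appendI)
qed

lemma eq_prd_CT:
  assumes "is_ctx Sg \<Gamma>" "is_ctx Sg \<Delta>"
  defines "\<Theta> \<equiv> \<Delta> @ \<Gamma>"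
  shows "EqP CT \<Theta> = ConnOp CT (tensor_conn LL) (\<Theta> @ \<Theta>)
    [Reindex CT (\<Theta> @ \<Theta>) (\<Gamma> @ \<Gamma>) (square CT \<Theta> \<Gamma> (Fst CT \<Gamma> \<Delta>)) (EqP CT \<Gamma>),
     Reindex CT (\<Theta> @ \<Theta>) (\<Delta> @ \<Delta>) (square CT \<Theta> \<Delta> (Snd CT \<Gamma> \<Delta>)) (EqP CT \<Delta>)]"
proof -
  let ?E = "\<lambda>i. Eql (\<Theta> ! i) (Var (length \<Theta> + i)) (Var i) :: ('q, 'c, 's, 'f, 'r) fm"
  let ?n = "length \<Delta>"
  let ?\<phi>s = "rev (map ?E [?n..<?n + length \<Gamma>])" and ?\<psi>s = "rev (map ?E [0..<?n])"
  have \<Theta>: "is_ctx Sg \<Theta>" using assms by simp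
  have F: "Reindex CT (\<Theta> @ \<Theta>) (\<Gamma> @ \<Gamma>) (square CT \<Theta> \<Gamma> (Fst CT \<Gamma> \<Delta>)) (EqP CT \<Gamma>) =
      fm_class T (\<Theta> @ \<Theta>) (tensor_list LL ?\<phi>s)"
    using Reindex_square_EqP[OF assms(1) \<Theta>, of ?n] sorted_Fst[of \<Delta> \<Gamma>] by (simp add: \<Theta>_def Fst_CT)
  have S: "Reindex CT (\<Theta> @ \<Theta>) (\<Delta> @ \<Delta>) (square CT \<Theta> \<Delta> (Snd CT \<Gamma> \<Delta>)) (EqP CT \<Delta>) =
      fm_class T (\<Theta> @ \<Theta>) (tensor_list LL ?\<psi>s)"
    using Reindex_square_EqP[OF assms(2) \<Theta>, of 0] sorted_Snd[of \<Delta> \<Gamma>] by (simp add: \<Theta>_def Snd_CT)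
  have "wf_fm LL Sg (\<Theta> @ \<Theta>) (?E i)" if "i < length \<Theta>" for i
    using \<Theta> that has_sort_shift[of i \<Theta> Sg \<Theta>] has_sort.Var[of i "\<Theta> @ \<Theta>" Sg]
    by (intro wf_fm.Eql) (auto simp: is_ctx_def nth_append)
  then have wf: "\<forall>\<phi> \<in> set ?\<phi>s \<union> set ?\<psi>s. wf_fm LL Sg (\<Theta> @ \<Theta>) \<phi>"
    by (auto simp: \<Theta>_def)
  \<comment> \<open>The indices of \<Delta> come first, but \<open>eq_fm\<close> reverses the list,
    so the equations of \<Gamma> precede those of \<Delta>. The order matters: the rules provide no
    commutativity of the tensor.\<close>
  have "[0..<length \<Theta>] = [0..<?n] @ [?n..<?n + length \<Gamma>]"
    using upt_add_eq_append[of 0 ?n "length \<Gamma>"] by (simp add: \<Theta>_def)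
  then have "eq_fm LL \<Theta> = tensor_list LL (?\<phi>s @ ?\<psi>s)"
    by (simp add: eq_fm_def)
  with tensor_list_append[OF _ wf] have "EqP CT \<Theta> =
      fm_class T (\<Theta> @ \<Theta>) (tensor LL (tensor_list LL ?\<phi>s) (tensor_list LL ?\<psi>s))"
    using \<Theta> by (simp add: EqP_CT fm_class_eqI)
  then show ?thesis
    unfolding F S using \<Theta> wf by (simp add: tensor_fm_class wf_tensor_list)
qed

section \<open>The remaining axioms of an object of FA, and adequacy\<close>

lemma FA_object_CT: "FA_object LL CT"
proof -
  interpret prop_category CT by (rule prop_category_CT)
  show ?thesis
  proof (intro FA_object.intro prop_category_CT FA_object_axioms.intro)
    fix \<Gamma> k As assume "\<Gamma> \<in> Obj CT" "conns LL k = Some (length As)" "set As \<subseteq> Pred CT \<Gamma>"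
    then show "ConnOp CT k \<Gamma> As \<in> Pred CT \<Gamma>"
      by (auto simp: ConnOp_fm_class intro!: fm_class_pred wf_fm.Conn elim!: preds_cases)
  next
    fix \<Gamma> \<Delta> f k As
    assume *: "\<Gamma> \<in> Obj CT" "\<Delta> \<in> Obj CT" "f \<in> Hom CT \<Gamma> \<Delta>" "conns LL k = Some (length As)"
      "set As \<subseteq> Pred CT \<Delta>"
    obtain Ms where Ms: "list_all2 (has_sort Sg \<Gamma>) Ms \<Delta>" "f = mor_class T \<Gamma> \<Delta> Ms"
      using * by (auto elim: hom_cases)
    obtain \<phi>s where \<phi>s: "\<forall>\<phi> \<in> set \<phi>s. wf_fm LL Sg \<Delta> \<phi>" and As: "As = map (fm_class T \<Delta>) \<phi>s"
      using *(5) by (rule preds_cases)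
    have "map (Reindex CT \<Gamma> \<Delta> f) As = map (fm_class T \<Gamma>) (map (fsubst (inst Ms)) \<phi>s)"
      using * Ms \<phi>s by (simp add: As Reindex_fm_class)
    moreover have "\<forall>\<phi> \<in> set (map (fsubst (inst Ms)) \<phi>s). wf_fm LL Sg \<Gamma> \<phi>"
      using \<phi>s Ms(1) by (auto intro: wf_fm_inst)
    moreover have "wf_fm LL Sg \<Delta> (Conn k \<phi>s)"
      using * \<phi>s As by (auto intro: wf_fm.Conn)
    ultimately show "Reindex CT \<Gamma> \<Delta> f (ConnOp CT k \<Delta> As) = ConnOp CT k \<Gamma> (map (Reindex CT \<Gamma> \<Delta> f) As)"
      using * Ms \<phi>s As by (simp add: ConnOp_fm_class Reindex_fm_class del: map_map)
  next
    fix \<Gamma> assume "\<Gamma> \<in> Obj CT"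
    then show "EqP CT \<Gamma> \<in> Pred CT (Prd CT \<Gamma> \<Gamma>)"
      by (simp add: EqP_CT fm_class_pred wf_eq_fm)
  next
    fix Q \<Gamma> \<Delta> A
    assume "Q \<in> quants LL" "\<Gamma> \<in> Obj CT" "\<Delta> \<in> Obj CT" "A \<in> Pred CT (Prd CT \<Gamma> \<Delta>)"
    then show "QntOp CT Q \<Gamma> \<Delta> A \<in> Pred CT \<Gamma>"
      by (auto simp: QntOp_fm_class intro!: fm_class_pred wf_fm_qnt_iter elim!: pred_cases)
  next
    fix Q \<Gamma> \<Delta> \<Theta> f A
    assume "Q \<in> quants LL" "\<Gamma> \<in> Obj CT" "\<Delta> \<in> Obj CT" "\<Theta> \<in> Obj CT" "f \<in> Hom CT \<Gamma> \<Delta>"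
      "A \<in> Pred CT (Prd CT \<Delta> \<Theta>)"
    then show "QntOp CT Q \<Gamma> \<Theta> (Reindex CT (Prd CT \<Gamma> \<Theta>) (Prd CT \<Delta> \<Theta>) (times_ide CT \<Gamma> \<Delta> \<Theta> f) A) =
        Reindex CT \<Gamma> \<Delta> f (QntOp CT Q \<Delta> \<Theta> A)"
      by (simp add: qnt_natural_CT)
  next
    fix \<Gamma> assume "\<Gamma> \<in> Obj CT"
    then show "monoid \<lparr>carrier = Pred CT \<Gamma>, mult = (\<lambda>p q. ConnOp CT (tensor_conn LL) \<Gamma> [p, q]),
        one = ConnOp CT (unit_conn LL) \<Gamma> []\<rparr>"
      by (simp add: tensor_monoid_CT)
  next
    fix Q \<Gamma> A assume "Q \<in> quants LL" "\<Gamma> \<in> Obj CT" "A \<in> Pred CT \<Gamma>"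
    \<comment> \<open>The product with the terminal object is \<Gamma> itself, so reindexing along
      the projection changes nothing and the quantifier ranges over no variable.\<close>
    moreover have "Fst CT \<Gamma> [] = Ide CT \<Gamma>"
      by (simp add: Fst_CT Ide_CT)
    ultimately show "QntOp CT Q \<Gamma> (One CT)
        (Reindex CT (Prd CT \<Gamma> (One CT)) \<Gamma> (Fst CT \<Gamma> (One CT)) A) = A"
      using QntOp_fm_class[of \<Gamma> "[]" Q] by (auto simp: reindex_ide elim!: pred_cases)
  next
    fix Q \<Gamma> \<Delta> \<Theta> A
    assume "Q \<in> quants LL" "\<Gamma> \<in> Obj CT" "\<Delta> \<in> Obj CT" "\<Theta> \<in> Obj CT"
      "A \<in> Pred CT (Prd CT (Prd CT \<Gamma> \<Delta>) \<Theta>)"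
    moreover from this obtain \<phi> where \<phi>: "wf_fm LL Sg (\<Theta> @ \<Delta> @ \<Gamma>) \<phi>" and A: "A = fm_class T (\<Theta> @ \<Delta> @ \<Gamma>) \<phi>"
      by (auto elim: pred_cases)
    ultimately show "QntOp CT Q \<Gamma> (Prd CT \<Delta> \<Theta>)
        (Reindex CT (Prd CT \<Gamma> (Prd CT \<Delta> \<Theta>)) (Prd CT (Prd CT \<Gamma> \<Delta>) \<Theta>) (reassoc CT \<Gamma> \<Delta> \<Theta>) A) =
        QntOp CT Q \<Gamma> \<Delta> (QntOp CT Q (Prd CT \<Gamma> \<Delta>) \<Theta> A)"
      using QntOp_fm_class[of \<Gamma> "\<Theta> @ \<Delta>" Q \<phi>]
      by (simp add: reassoc_CT reindex_ide A QntOp_fm_class wf_fm_qnt_iter qnt_iter_append)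
  next
    show "EqP CT (One CT) = ConnOp CT (unit_conn LL) (Prd CT (One CT) (One CT)) []"
      by (simp add: EqP_CT eq_fm_def unit_fm_class)
  next
    fix \<Gamma> \<Delta> assume "\<Gamma> \<in> Obj CT" "\<Delta> \<in> Obj CT"
    then show "EqP CT (Prd CT \<Gamma> \<Delta>) =
        (let c = Prd CT \<Gamma> \<Delta> in ConnOp CT (tensor_conn LL) (Prd CT c c)
          [Reindex CT (Prd CT c c) (Prd CT \<Gamma> \<Gamma>) (square CT c \<Gamma> (Fst CT \<Gamma> \<Delta>)) (EqP CT \<Gamma>),
           Reindex CT (Prd CT c c) (Prd CT \<Delta> \<Delta>) (square CT c \<Delta> (Snd CT \<Gamma> \<Delta>)) (EqP CT \<Delta>)])"
      using eq_prd_CT[of \<Gamma> \<Delta>] by (simp add: Let_def)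
  qed
qed


end

theorem mainTheorem1:
  fixes LL :: "('q, 'c) lang" and L :: "('q, 'c, 's, 'f, 'r) logic"
  assumes "wf_lang LL"
    and "is_logic LL L"
    and "contains_rules LL L (Lm_rule LL)"
  shows "adequate LL L"
  unfolding adequate_def
proof (intro allI impI)
  fix Sg T assume *: "wf_sig Sg \<and> is_theory_of LL L Sg T"
  then have T: "T \<subseteq> assertions LL Sg" "L Sg T = T" and cl: "closure_operator_on (assertions LL Sg) (L Sg)"
    using assms(2) by (auto simp: is_theory_of_def is_logic_def)
  \<comment> \<open>Containing a rule places its conclusion only in the closure of its own premises;
    monotonicity and \<open>L Sg T = T\<close> carry it into \<open>T\<close>.\<close>
  have closed: "a \<in> T" if "contains_rules LL L R" "R A a" "A \<subseteq> T" "wf_assertion LL Sg a" for R A a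
  proof -
    have "a \<in> L Sg A"
      using that * T(1) unfolding contains_rules_def assertions_def by blast
    also have "L Sg A \<subseteq> L Sg T"
      using cl that(3) T(1) by (simp add: closure_operator_on_def)
    finally show ?thesis using T(2) by simp
  qed
  interpret closed_theory LL Sg T
    using assms * T(1) closed by unfold_locales (auto simp: is_logic_def)
  show "classifying_well_defined LL Sg T \<and> FA_object LL (classifying LL Sg T)"
    using well_defined FA_object_CT by blast
qed

end
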